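(* Let $G$ be a chordal graph. If $G$ is stiff and the vertex connectivity of $G$ is $n$, then $\mathrm{Conn}(\mathcal{N}(G))<n$.
   Context: Graphs are finite, undirected, without loops or multiple edges. A graph is chordal if it has no induced subgraph isomorphic to a cycle $C_k$ with $k\ge 4$. A graph $G$ is stiff if there are no two distinct vertices $u,v$ with $N_G(u)\subseteq N_G(v)$, where $N_G(\cdot)$ is the set of neighbours. A graph is $k$-connected if for any two distinct vertices $x,y$ there are at least $k$ internally disjoint $xy$-paths (pairwise sharing only $x,y$; a single edge $xy$ counts as one path); the vertex connectivity $\kappa(G)$ is the maximum $k$ for which $G$ is $k$-connected. The neighbourhood complex $\mathcal{N}(G)$ is the simplicial complex whose simplices are the subsets $\sigma\subseteq V(G)$ whose elements have a common neighbour in $G$. A nonempty topological space $X$ is $k$-connected if every map from $S^m$ to $X$ extends to a map from $D^{m+1}$ to $X$, for $m=0,1,\dots,k$; $\mathrm{Conn}(X)$ is the largest integer $k$ such that $X$ is $k$-connected, with $\mathrm{Conn}(X)=-1$ for a nonempty disconnected space. For a simplicial complex this refers to its geometric realization. *)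

theory Defs
  imports
    "HOL-Analysis.Analysis"
    "HOL-Library.Extended_Nat"
    "HOL-Library.Extended_Real"
    "Graph_Theory.Graph_Theory"
begin

text \<open>
  Finite simple undirected graphs are the digraphs satisfying the predicate \<open>graph\<close> of the
  entry \<open>Graph_Theory\<close>: finite, loop-free, without parallel arcs, and symmetric, so that an
  undirected edge \<open>uv\<close> is the pair of arcs \<open>u \<rightarrow> v\<close> and \<open>v \<rightarrow> u\<close>.
\<close>

subsection \<open>Graphs\<close>

definition cycle_graph :: "nat \<Rightarrow> nat pair_pre_digraph" where
  "cycle_graph k =
     \<lparr> pverts = {..<k},
       parcs = {(i, j). i < k \<and> j < k \<and> (j = (i + 1) mod k \<or> i = (j + 1) mod k)} \<rparr>"

definition chordal :: "('a, 'b) pre_digraph \<Rightarrow> bool" where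
  "chordal G \<longleftrightarrow>
     \<not> (\<exists>k\<ge>4. \<exists>H. induced_subgraph H G \<and> digraph_iso (with_proj (cycle_graph k)) H)"

definition nbhd :: "('a, 'b) pre_digraph \<Rightarrow> 'a \<Rightarrow> 'a set" where
  "nbhd G u = {v. u \<rightarrow>\<^bsub>G\<^esub> v}"

definition stiff :: "('a, 'b) pre_digraph \<Rightarrow> bool" where
  "stiff G \<longleftrightarrow>
     \<not> (\<exists>u\<in>verts G. \<exists>v\<in>verts G. u \<noteq> v \<and> nbhd G u \<subseteq> nbhd G v)"

definition internally_disjoint_paths ::
    "('a, 'b) pre_digraph \<Rightarrow> 'a \<Rightarrow> 'a \<Rightarrow> 'a list set \<Rightarrow> bool" where
  "internally_disjoint_paths G x y P \<longleftrightarrow>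
     (\<forall>p\<in>P. vpath p G \<and> hd p = x \<and> last p = y) \<and>
     (\<forall>p\<in>P. \<forall>q\<in>P. p \<noteq> q \<longrightarrow> set p \<inter> set q = {x, y})"

definition graph_k_connected :: "nat \<Rightarrow> ('a, 'b) pre_digraph \<Rightarrow> bool" where
  "graph_k_connected k G \<longleftrightarrow>
     (\<forall>x\<in>verts G. \<forall>y\<in>verts G. x \<noteq> y \<longrightarrow>
        (\<exists>P. finite P \<and> k \<le> card P \<and> internally_disjoint_paths G x y P))"

text \<open>
  Every graph is \<open>0\<close>-connected and \<open>k\<close>-connectedness is inherited by smaller \<open>k\<close>, so the
  supremum is the maximum whenever the latter exists. It is \<open>\<infinity>\<close> exactly when there is no
  maximum, which for finite graphs means that there are fewer than two vertices.
\<close>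

definition vertex_connectivity :: "('a, 'b) pre_digraph \<Rightarrow> enat" where
  "vertex_connectivity G = (SUP k\<in>{k. graph_k_connected k G}. enat k)"

subsection \<open>Simplicial complexes\<close>

definition neighbourhood_complex :: "('a, 'b) pre_digraph \<Rightarrow> 'a set set" where
  "neighbourhood_complex G =
     {\<sigma>. \<sigma> \<subseteq> verts G \<and> (\<exists>w\<in>verts G. \<forall>v\<in>\<sigma>. v \<in> nbhd G w)}"

text \<open>
  The points of the realization are given by their barycentric coordinates. The product topology
  is the right one for complexes on a finite vertex set, the only ones used here.
  The empty set may belong to \<open>K\<close> but contributes no point, since the coordinates sum to \<open>1\<close>.
\<close>

definition geometric_realization :: "'a set set \<Rightarrow> ('a \<Rightarrow> real) topology" where
  "geometric_realization K =
     subtopology (powertop_real UNIV)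
       {f. (\<forall>v. 0 \<le> f v) \<and> {v. f v \<noteq> 0} \<in> K \<and> (\<Sum>v\<in>{v. f v \<noteq> 0}. f v) = 1}"

subsection \<open>Connectedness of spaces\<close>

definition nball :: "nat \<Rightarrow> (nat \<Rightarrow> real) topology" where
  "nball m = subtopology (Euclidean_space m) {x. (\<Sum>i<m. x i ^ 2) \<le> 1}"

definition space_k_connected :: "int \<Rightarrow> 'a topology \<Rightarrow> bool" where
  "space_k_connected k X \<longleftrightarrow>
     topspace X \<noteq> {} \<and>
     (\<forall>m::nat. int m \<le> k \<longrightarrow>
        (\<forall>f. continuous_map (nsphere m) X f \<longrightarrow>
           (\<exists>g. continuous_map (nball (Suc m)) X g \<and>
                (\<forall>x\<in>topspace (nsphere m). g x = f x))))"

text \<open>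
  The condition is vacuous for negative \<open>k\<close>, so every nonempty space is \<open>(-1)\<close>-connected. Hence
  the value is \<open>-1\<close> for a nonempty space that is not path-connected, and \<open>\<infinity>\<close> for a space that is
  \<open>k\<close>-connected for all \<open>k\<close>.
\<close>

definition Conn :: "'a topology \<Rightarrow> ereal" where
  "Conn X = (SUP k\<in>{k. space_k_connected k X}. ereal (real_of_int k))"

end

(*
  Two simplicial maps from N(G) onto the boundary sphere of a simplex detect non-trivial spheres.

  If v is simplicial, stiffness makes N(v) a facet that is contained in no other N(w), so collapsing
  everything outside the closed neighbourhood of v retracts N(G) onto a sphere of dimension
  deg v - 1.  This settles the case of a simplicial vertex of degree at most n.

  Otherwise a chordal graph of connectivity n has a clique separator S with n vertices between
  parts A and B.  Collapsing A to a vertex a and B to a vertex b maps N(G) to the boundary of the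
  simplex on S + a + b, an n-sphere, because a common neighbour in S of a simplex does not belong to
  that simplex.  Choosing a and b adjacent to all of S, the facets of this boundary that contain
  both a and b lift to N(G).  The facet S + a lifts up to homotopy within A: its boundary is
  exchanged through a chain of (n+1)-cliques, following an elimination order towards a clique that
  has a common neighbour, and this chain cannot stop earlier since simplicial vertices have
  degree greater than n.  The same holds for S + b.  An n-connected N(G) would therefore make the
  n-sphere contractible.
*)
theory Submission
  imports Defs "HOL-Homology.Homology"
begin

section \<open>Chordal graphs\<close>

text \<open>The obstacle in the separator case is that the clique \<open>S + a\<close> need not be a
  simplex of the complex: its vertices are pairwise adjacent but may have no common neighbour. Hence
  the sphere is completed by extending the inclusion of a boundary continuously, and the extension
  is kept over \<open>A \<union> S\<close>, so that collapsing \<open>A\<close> and \<open>B\<close>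
  does not move points out of their carriers.

  Chordality acts through perfect elimination orders. The later neighbours of a vertex that misses
  some later vertex form a clique separating the whole graph. With n-connectedness this bounds their
  number below by n, which keeps the cliques of the chain at size n+1. Conversely, if all clique
  separators had more than n vertices, disjoint paths could be built along the order, so failure of
  (n+1)-connectedness yields \<open>S\<close> already as a clique.

  The simplex on \<open>S + a + b\<close> has n+2 vertices, so its boundary is the sphere of the
  highest dimension that an n-connected space must fill. The contradiction rests on the
  non-contractibility of spheres alone. Vertex sets are parameters beside a fixed adjacency
  relation, so induced subgraphs are just subsets.\<close>

locale sgraph =
  fixes E :: "'a \<Rightarrow> 'a \<Rightarrow> bool"
  assumes E_sym: "E u v \<Longrightarrow> E v u" and E_irrefl: "\<not> E u u"
begin

definition clique :: "'a set \<Rightarrow> bool" where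
  "clique K \<longleftrightarrow> (\<forall>u\<in>K. \<forall>v\<in>K. u \<noteq> v \<longrightarrow> E u v)"

definition nb :: "'a set \<Rightarrow> 'a \<Rightarrow> 'a set" where
  "nb V v = {u\<in>V. E v u}"

definition simplicial :: "'a set \<Rightarrow> 'a \<Rightarrow> bool" where
  "simplicial V v \<longleftrightarrow> v \<in> V \<and> clique (nb V v)"

text \<open>\<open>S\<close> may be empty, which covers disconnected graphs. \<open>A\<close> and
  \<open>B\<close> are unions of components of the rest, not necessarily single components, so
  vertices can be added to either side.\<close>

definition separation :: "'a set \<Rightarrow> 'a set \<Rightarrow> 'a set \<Rightarrow> 'a set \<Rightarrow> bool" where
  "separation V A S B \<longleftrightarrow> V = A \<union> S \<union> B \<and> A \<noteq> {} \<and> B \<noteq> {} \<and>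
     A \<inter> S = {} \<and> B \<inter> S = {} \<and> A \<inter> B = {} \<and> (\<forall>a\<in>A. \<forall>b\<in>B. \<not> E a b)"

text \<open>Chordality relative to a vertex set: \<open>c\<close> lists an induced cycle in cyclic
  order. No subgraph is formed, so heredity is immediate.\<close>

definition no_hole :: "'a set \<Rightarrow> bool" where
  "no_hole V \<longleftrightarrow> \<not> (\<exists>k\<ge>4. \<exists>c::nat \<Rightarrow> 'a. inj_on c {..<k} \<and> c ` {..<k} \<subseteq> V \<and>
     (\<forall>i<k. \<forall>j<k. E (c i) (c j) \<longleftrightarrow> j = (i + 1) mod k \<or> i = (j + 1) mod k))"

text \<open>The neighbours still present when \<open>v\<close> is removed, if vertices are
  eliminated by increasing \<open>r\<close>. An order is a perfect elimination order when all these
  sets are cliques.\<close>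

definition later :: "'a set \<Rightarrow> ('a \<Rightarrow> nat) \<Rightarrow> 'a \<Rightarrow> 'a set" where
  "later V r v = {u\<in>V. E v u \<and> r v < r u}"

lemma clique_subset: "clique K \<Longrightarrow> L \<subseteq> K \<Longrightarrow> clique L"
  unfolding clique_def by blast

lemma no_hole_subset: "no_hole V \<Longrightarrow> W \<subseteq> V \<Longrightarrow> no_hole W"
  unfolding no_hole_def by (meson subset_trans)

lemma clique_insert: "clique K \<Longrightarrow> \<forall>u\<in>K. E v u \<Longrightarrow> clique (insert v K)"
  unfolding clique_def using E_sym by blast

lemma separation_commute: "separation V A S B \<Longrightarrow> separation V B S A"
  unfolding separation_def using E_sym by blast

section \<open>Induced paths and the attachment of components\<close>

text \<open>A walk of least length with these ends and with interior in \<open>C\<close> works: a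
  chord or a repeated vertex would give a shorter one.\<close>

lemma induced_path:
  assumes walk: "p0 (0::nat) = s" "p0 r0 = t" "\<forall>i<r0. E (p0 i) (p0 (Suc i))"
      "\<forall>i. 0 < i \<and> i < r0 \<longrightarrow> p0 i \<in> C"
    and st: "s \<noteq> t" "s \<notin> C" "t \<notin> C"
  obtains r p where "p 0 = s" "p r = t" "\<forall>i. 0 < i \<and> i < r \<longrightarrow> p i \<in> C" "inj_on p {..r}"
    "\<forall>i\<le>r. \<forall>j\<le>r. E (p i) (p j) \<longleftrightarrow> j = Suc i \<or> i = Suc j"
proof -
  define W where "W r p \<longleftrightarrow> p 0 = s \<and> p r = t \<and> (\<forall>i<r. E (p i) (p (Suc i))) \<and>
      (\<forall>i. 0 < i \<and> i < r \<longrightarrow> p i \<in> C)" for r and p :: "nat \<Rightarrow> 'a"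
  have ex: "\<exists>p. W r0 p"
    using walk unfolding W_def by blast
  define r where "r = (LEAST r. \<exists>p. W r p)"
  have "\<exists>p. W r p"
    unfolding r_def by (rule LeastI[of "\<lambda>r. \<exists>p. W r p"]) (rule ex)
  then obtain p where p: "W r p" by blast
  have least: "r \<le> r'" if "W r' p'" for r' p'
    unfolding r_def using that by (intro Least_le) blast
  \<comment> \<open>An edge from position \<open>i\<close> to position \<open>Suc i + d\<close>
    permits cutting out the \<open>d\<close> vertices in between.\<close>
  have no_shortcut: "d = 0" if "E (p i) (p (Suc i + d))" "Suc i + d \<le> r" for i d
  proof -
    define p' where "p' l = (if l \<le> i then p l else p (l + d))" for l
    have "W (r - d) p'"
      unfolding W_def
    proof (intro conjI allI impI)
      show "p' 0 = s" using p by (simp add: p'_def W_def)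
      show "p' (r - d) = t" using p that(2) by (auto simp add: p'_def W_def)
      show "E (p' l) (p' (Suc l))" if "l < r - d" for l
        using p that \<open>E (p i) (p (Suc i + d))\<close> unfolding p'_def W_def
        by (cases "l < i"; cases "l = i") auto
      show "p' l \<in> C" if "0 < l \<and> l < r - d" for l
        using p that unfolding p'_def W_def by auto
    qed
    from least[OF this] that(2) show ?thesis by linarith
  qed
  have edge: "j = Suc i" if "E (p i) (p j)" "i < j" "j \<le> r" for i j
    using no_shortcut[of i "j - Suc i"] that by auto
  have neq: "p i \<noteq> p j" if "i < j" "j \<le> r" for i j
  proof
    assume eq: "p i = p j"
    show False
    \<comment> \<open>A repetition of the endpoint \<open>t\<close> can only occur at position 0, as
      the interior lies in \<open>C\<close>. At any other repetition the edge leaving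
      \<open>p j\<close> is a shortcut from \<open>p i\<close>.\<close>
    proof (cases "j = r")
      case True
      then have "p i = t" using eq p by (simp add: W_def)
      then show False using that True st p unfolding W_def by (metis gr0I)
    next
      case False
      then have "E (p j) (p (Suc j))" using p that by (simp add: W_def)
      then have "E (p i) (p (Suc i + (j - i)))" using eq that by simp
      from no_shortcut[OF this] that False show False by auto
    qed
  qed
  show ?thesis
  proof
    show "p 0 = s" "p r = t" "\<forall>i. 0 < i \<and> i < r \<longrightarrow> p i \<in> C"
      using p by (auto simp: W_def)
    show "inj_on p {..r}"
      using neq by (metis atMost_iff inj_onI nat_neq_iff)
    have adj: "E (p i) (p (Suc i))" if "Suc i \<le> r" for i
      using p that by (simp add: W_def)
    show "\<forall>i\<le>r. \<forall>j\<le>r. E (p i) (p j) \<longleftrightarrow> j = Suc i \<or> i = Suc j"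
    proof (intro allI impI iffI)
      fix i j assume ij: "i \<le> r" "j \<le> r" and e: "E (p i) (p j)"
      then show "j = Suc i \<or> i = Suc j"
        using edge[of i j] edge[of j i] E_sym[OF e] E_irrefl by (metis nat_neq_iff)
    next
      fix i j assume "i \<le> r" "j \<le> r" "j = Suc i \<or> i = Suc j"
      then show "E (p i) (p j)" using adj E_sym by blast
    qed
  qed
qed

lemma walk_joining_neighbours:
  assumes reach: "(\<lambda>a b. E a b \<and> a \<in> C \<and> b \<in> C)\<^sup>*\<^sup>* u v" and u: "u \<in> C" "E s u" and v: "v \<in> C" "E v t"
  obtains r p where "p (0::nat) = s" "p r = t" "\<forall>i<r. E (p i) (p (Suc i))"
    "\<forall>i. 0 < i \<and> i < r \<longrightarrow> p i \<in> C"
proof -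
  obtain n f where f: "f 0 = u" "f n = v" "\<forall>i<n. E (f i) (f (Suc i)) \<and> f i \<in> C \<and> f (Suc i) \<in> C"
    using reach[unfolded rtranclp_power relpowp_fun_conv] by blast
  have fC: "f i \<in> C" if "i \<le> n" for i
    using that f u by (cases i) auto
  define p where "p i = (if i = 0 then s else if i = n + 2 then t else f (i - 1))" for i
  show ?thesis
  proof (rule that[of p "n + 2"])
    show "\<forall>i<n + 2. E (p i) (p (Suc i))"
    proof (intro allI impI)
      fix i assume i: "i < n + 2"
      show "E (p i) (p (Suc i))"
      proof (cases i)
        case 0 then show ?thesis using f u by (simp add: p_def)
      next
        case (Suc k)
        then show ?thesis using f v i by (cases "k = n") (auto simp add: p_def)
      qed
    qed
    show "\<forall>i. 0 < i \<and> i < n + 2 \<longrightarrow> p i \<in> C"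
      using fC by (auto simp add: p_def)
  qed (auto simp: p_def)
qed

text \<open>
  A component of the non-neighbours of \<open>x\<close> attaches to \<open>N(x)\<close> along a clique: two non-adjacent
  attachments \<open>s\<close>, \<open>t\<close> would form a hole with \<open>x\<close> and a shortest path between them.
\<close>

lemma attachment_clique:
  assumes hole: "no_hole V" and x: "x \<in> V" and CV: "C \<subseteq> V"
    and xC: "x \<notin> C" "\<forall>c\<in>C. \<not> E x c"
    and conn: "\<And>u v. u \<in> C \<Longrightarrow> v \<in> C \<Longrightarrow> (\<lambda>a b. E a b \<and> a \<in> C \<and> b \<in> C)\<^sup>*\<^sup>* u v"
  shows "clique {s \<in> V. E x s \<and> (\<exists>c\<in>C. E s c)}"
  unfolding clique_def
proof (intro ballI impI, rule ccontr)
  fix s t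
  assume s: "s \<in> {s \<in> V. E x s \<and> (\<exists>c\<in>C. E s c)}" and t: "t \<in> {s \<in> V. E x s \<and> (\<exists>c\<in>C. E s c)}"
    and st: "s \<noteq> t" "\<not> E s t"
  have sC: "s \<notin> C" "t \<notin> C" using s t xC by auto
  obtain u v where uv: "u \<in> C" "E s u" "v \<in> C" "E t v" using s t by blast
  obtain r0 p0 where p0: "p0 (0::nat) = s" "p0 r0 = t" "\<forall>i<r0. E (p0 i) (p0 (Suc i))"
    "\<forall>i. 0 < i \<and> i < r0 \<longrightarrow> p0 i \<in> C"
    by (rule walk_joining_neighbours[OF conn[OF uv(1,3)] uv(1,2,3) E_sym[OF uv(4)]])
  obtain r p where
    p: "p 0 = s" "p r = t" "\<forall>i. 0 < i \<and> i < r \<longrightarrow> p i \<in> C" "inj_on p {..r}"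
    "\<forall>i\<le>r. \<forall>j\<le>r. E (p i) (p j) \<longleftrightarrow> j = Suc i \<or> i = Suc j"
    by (rule induced_path[where ?p0.0 = p0 and s = s and ?r0.0 = r0 and t = t and C = C, OF p0 st(1) sC])
  have r2: "2 \<le> r"
  proof (rule ccontr)
    assume "\<not> 2 \<le> r"
    then have "r = 0 \<or> r = 1" by auto
    then show False
    proof
      assume "r = 0" then show False using p st by simp
    next
      assume "r = 1" then show False using p(1,2) p(5)[rule_format, of 0 1] st by simp
    qed
  qed
  \<comment> \<open>The cycle has \<open>r + 2\<close> vertices, with \<open>x\<close> at index
    \<open>r + 1\<close>, so that modulo \<open>r + 2\<close> its two neighbours are the ends at
    indices \<open>r\<close> and 0. Non-adjacency of \<open>s\<close> and \<open>t\<close> gives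
    \<open>2 \<le> r\<close>, hence length at least 4.\<close>
  define c where "c i = (if i \<le> r then p i else x)" for i
  have pV: "p i \<in> V" if "i \<le> r" for i
    using p(1,2,3) s t CV that by (cases "i = 0"; cases "i = r") auto
  have px: "p i \<noteq> x" if "i \<le> r" for i
    using p(1,2,3) s t xC that E_irrefl by (cases "i = 0"; cases "i = r") auto
  have Ex: "E x (p i) \<longleftrightarrow> i = 0 \<or> i = r" if "i \<le> r" for i
    using p(1,2,3) s t xC that by (cases "i = 0"; cases "i = r") auto
  have Ex': "E (p i) x \<longleftrightarrow> i = 0 \<or> i = r" if "i \<le> r" for i
    using Ex[OF that] E_sym by blast
  have inj: "inj_on c {..<r + 2}"
  proof (rule inj_onI)
    fix i j assume ij: "i \<in> {..<r + 2}" "j \<in> {..<r + 2}" and eq: "c i = c j"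
    show "i = j"
    proof (cases "i \<le> r")
      case True
      then have "j \<le> r" using eq px[of i] by (auto simp: c_def split: if_splits)
      then show ?thesis using True eq inj_onD[OF p(4)] by (simp add: c_def)
    next
      case False
      then have "\<not> j \<le> r" using eq px[of j] by (auto simp: c_def split: if_splits)
      then show ?thesis using False ij by simp
    qed
  qed
  have adj: "E (c i) (c j) \<longleftrightarrow> j = (i + 1) mod (r + 2) \<or> i = (j + 1) mod (r + 2)"
    if ij: "i < r + 2" "j < r + 2" for i j
  proof -
    have md: "(l + 1) mod (r + 2) = (if l = r + 1 then 0 else l + 1)" if "l < r + 2" for l
      using that by (cases "l = r + 1") auto
    consider "i \<le> r" "j \<le> r" | "i = r + 1" "j \<le> r" | "i \<le> r" "j = r + 1" | "i = r + 1" "j = r + 1"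
      using ij by linarith
    then show ?thesis
    proof cases
      case 1
      then show ?thesis using p(5) ij by (auto simp: c_def md)
    next
      case 2
      then show ?thesis using Ex[of j] ij by (auto simp: c_def md)
    next
      case 3
      then show ?thesis using Ex'[of i] ij by (auto simp: c_def md)
    next
      case 4
      then show ?thesis using E_irrefl ij by (auto simp: c_def md)
    qed
  qed
  have "c ` {..<r + 2} \<subseteq> V" using pV x by (auto simp: c_def)
  moreover have "4 \<le> r + 2" using r2 by simp
  moreover have "\<forall>i<r + 2. \<forall>j<r + 2. E (c i) (c j) \<longleftrightarrow> j = (i + 1) mod (r + 2) \<or> i = (j + 1) mod (r + 2)"
    using adj by blast
  ultimately show False
    using hole inj unfolding no_hole_def by blast
qed

section \<open>Dirac's theorem on simplicial vertices\<close>

text \<open>Let \<open>C\<close> be the component of \<open>y\<close> among the non-neighbours of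
  \<open>x\<close>, and \<open>S\<close> its attachment in the neighbourhood of \<open>x\<close>, a
  clique. Induction applies to \<open>C \<union> S\<close>, which misses \<open>x\<close>. A
  simplicial vertex found there inside \<open>C\<close> is simplicial in \<open>V\<close>, because
  all neighbours of \<open>C\<close> lie in \<open>C \<union> S\<close>.\<close>

lemma simplicial_avoiding_vertex:
  assumes "finite V" "no_hole V" "x \<in> V" "y \<in> V" "y \<noteq> x" "\<not> E x y"
  shows "\<exists>w. simplicial V w \<and> w \<noteq> x \<and> \<not> E x w"
  using assms
proof (induction "card V" arbitrary: V x y rule: less_induct)
  case less
  define R where "R = (\<lambda>a b. E a b \<and> a \<in> V \<and> b \<in> V \<and> a \<noteq> x \<and> b \<noteq> x \<and> \<not> E x a \<and> \<not> E x b)"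
  define C where "C = {c. R\<^sup>*\<^sup>* y c}"
  have CV: "c \<in> V \<and> c \<noteq> x \<and> \<not> E x c" if "c \<in> C" for c
  proof -
    have "R\<^sup>*\<^sup>* y c" using that by (simp add: C_def)
    then show ?thesis by (induction rule: rtranclp_induct) (use less.prems in \<open>auto simp: R_def\<close>)
  qed
  have yC: "y \<in> C" by (simp add: C_def)
  have closed: "d \<in> C" if "c \<in> C" "E c d" "d \<in> V" "d \<noteq> x" "\<not> E x d" for c d
    using that CV[OF that(1)] unfolding C_def R_def by (auto intro: rtranclp.rtrancl_into_rtrancl)
  have conn_y: "(\<lambda>a b. E a b \<and> a \<in> C \<and> b \<in> C)\<^sup>*\<^sup>* y c" if "c \<in> C" for c
  proof -
    have "R\<^sup>*\<^sup>* y c" using that by (simp add: C_def)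
    then show ?thesis
    proof (induction rule: rtranclp_induct)
      case (step b c)
      then have "b \<in> C" "c \<in> C" unfolding C_def by auto
      moreover have "E b c" using step by (simp add: R_def)
      ultimately show ?case using step.IH by (auto intro: rtranclp.rtrancl_into_rtrancl)
    qed simp
  qed
  have symp: "symp (\<lambda>a b. E a b \<and> a \<in> C \<and> b \<in> C)"
    by (auto intro!: sympI E_sym)
  have conn: "(\<lambda>a b. E a b \<and> a \<in> C \<and> b \<in> C)\<^sup>*\<^sup>* u v" if "u \<in> C" "v \<in> C" for u v
    using conn_y[OF that(1)] conn_y[OF that(2)] symp
    by (metis (no_types, lifting) rtranclp_trans symp_rtranclp sympD)
  define S where "S = {s \<in> V. E x s \<and> (\<exists>c\<in>C. E s c)}"
  have cliqueS: "clique S"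
    unfolding S_def
    by (rule attachment_clique[OF less.prems(2,3)]) (use CV conn in auto)
  have nbC: "nb V c \<subseteq> C \<union> S" if "c \<in> C" for c
    using that closed[OF that] CV[OF that] E_sym unfolding nb_def S_def by blast
  have lift: "simplicial V w" if "simplicial (C \<union> S) w" "w \<in> C" for w
    using that nbC[OF that(2)] CV[OF that(2)] unfolding simplicial_def nb_def
    by (auto elim!: clique_subset)
  have CSV: "C \<union> S \<subseteq> V" using CV by (auto simp: S_def)
  have small: "card (C \<union> S) < card V"
  proof (rule psubset_card_mono[OF less.prems(1)])
    have "x \<notin> C \<union> S" using CV E_irrefl by (auto simp: S_def)
    then show "C \<union> S \<subset> V" using CSV less.prems by blast
  qed
  have fin: "finite (C \<union> S)" by (rule finite_subset[OF CSV less.prems(1)])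
  have hole: "no_hole (C \<union> S)" by (rule no_hole_subset[OF less.prems(2) CSV])
  have IH: "\<exists>w. simplicial (C \<union> S) w \<and> w \<noteq> s \<and> \<not> E s w"
    if "s \<in> C \<union> S" "u \<in> C \<union> S" "u \<noteq> s" "\<not> E s u" for s u
    by (rule less.hyps[OF small fin hole that])
  have "\<exists>w\<in>C. simplicial (C \<union> S) w"
  proof (cases "clique (C \<union> S)")
    case True
    then have "simplicial (C \<union> S) y"
      using yC by (auto simp: simplicial_def nb_def elim!: clique_subset)
    then show ?thesis using yC by blast
  next
    case False
    show ?thesis
    \<comment> \<open>The induction hypothesis is applied so that its vertex \<open>w\<close> falls
      into \<open>C\<close>. If some \<open>s\<close> in \<open>S\<close> has a non-neighbour, a
      \<open>w\<close> not adjacent to \<open>s\<close> is outside the clique \<open>S\<close>.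
      Otherwise every vertex of \<open>S\<close> is adjacent to all others, so a \<open>w\<close>
      not adjacent to some \<open>c\<close> in \<open>C\<close> is outside \<open>S\<close>.\<close>
    proof (cases "\<exists>s\<in>S. \<exists>u\<in>C \<union> S. u \<noteq> s \<and> \<not> E s u")
      case True
      then obtain s u where su: "s \<in> S" "u \<in> C \<union> S" "u \<noteq> s" "\<not> E s u" by blast
      from IH[of s u] su obtain w where w: "simplicial (C \<union> S) w" "w \<noteq> s" "\<not> E s w" by blast
      then have "w \<in> C" using cliqueS su(1) unfolding simplicial_def clique_def by auto
      then show ?thesis using w by blast
    next
      case univ: False
      then obtain c u where cu: "c \<in> C" "u \<in> C \<union> S" "u \<noteq> c" "\<not> E c u"
        using False unfolding clique_def by (metis E_sym UnE)
      from IH[of c u] cu obtain w where w: "simplicial (C \<union> S) w" "w \<noteq> c" "\<not> E c w" by blast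
      have "w \<notin> S"
      proof
        assume "w \<in> S"
        then have "E w c" using univ cu(1) w(2) by auto
        then show False using w(3) E_sym by blast
      qed
      then have "w \<in> C" using w(1) unfolding simplicial_def by blast
      then show ?thesis using w by blast
    qed
  qed
  then show ?case using lift CV by blast
qed

text \<open>The clique version lets an elimination order postpone a prescribed clique to the end.
  Either some member of \<open>K\<close> has a non-neighbour, or all members are universal; in both
  cases a simplicial vertex avoiding a suitable vertex avoids \<open>K\<close>.\<close>

lemma simplicial_avoiding_clique:
  assumes "finite V" "no_hole V" "clique K" "K \<subseteq> V" "K \<noteq> V"
  shows "\<exists>w\<in>V - K. simplicial V w"
proof (cases "clique V")
  case True
  then have "simplicial V w" if "w \<in> V" for w
    using that by (auto simp: simplicial_def nb_def elim!: clique_subset)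
  then show ?thesis using assms(4,5) by blast
next
  case False
  show ?thesis
  proof (cases "\<exists>s\<in>K. \<exists>u\<in>V. u \<noteq> s \<and> \<not> E s u")
    case True
    then obtain s u where su: "s \<in> K" "u \<in> V" "u \<noteq> s" "\<not> E s u" by blast
    with simplicial_avoiding_vertex[OF assms(1,2), of s u] assms
    obtain w where w: "simplicial V w" "w \<noteq> s" "\<not> E s w" by blast
    then have "w \<notin> K" using assms su(1) unfolding clique_def by auto
    then show ?thesis using w unfolding simplicial_def by blast
  next
    case univ: False
    then obtain c u where cu: "c \<in> V" "u \<in> V" "u \<noteq> c" "\<not> E c u"
      using False unfolding clique_def by blast
    with simplicial_avoiding_vertex[OF assms(1,2), of c u]
    obtain w where w: "simplicial V w" "w \<noteq> c" "\<not> E c w" by blast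
    have "w \<notin> K"
    proof
      assume "w \<in> K"
      then have "E w c" using univ cu(1) w(2) by auto
      then show False using w(3) E_sym by blast
    qed
    then show ?thesis using w unfolding simplicial_def by blast
  qed
qed

section \<open>Perfect elimination orders and the clique separators they produce\<close>

text \<open>Dirac's theorem always supplies a simplicial vertex of \<open>A \<union> S\<close>
  outside the clique \<open>S\<close>; removing such vertices one at a time ranks \<open>A\<close>.
  The set \<open>B\<close> can be placed above \<open>A\<close> because it sends no edges to
  \<open>A\<close> and so adds nothing to a later neighbourhood.\<close>

lemma elimination_order:
  assumes "finite A" "no_hole (A \<union> S)" "finite S" "clique S" "A \<inter> S = {}" "B \<inter> (A \<union> S) = {}"
    and "\<forall>a\<in>A. \<forall>b\<in>B. \<not> E a b"
  shows "\<exists>r::'a \<Rightarrow> nat. inj_on r A \<and> (\<forall>a\<in>A. \<forall>t\<in>S \<union> B. r a < r t) \<and>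
           (\<forall>a\<in>A. clique (later (A \<union> S \<union> B) r a))"
  using assms
proof (induction "card A" arbitrary: A)
  case 0
  then show ?case by auto
next
  case (Suc n)
  have "A \<noteq> {}" using Suc.hyps(2) by auto
  then have "A \<union> S \<noteq> S" using Suc.prems(5) by blast
  then have "\<exists>w\<in>(A \<union> S) - S. simplicial (A \<union> S) w"
    by (intro simplicial_avoiding_clique) (use Suc in auto)
  then obtain w where w: "w \<in> A" "simplicial (A \<union> S) w" by blast
  have c: "n = card (A - {w})" using Suc w by simp
  have "\<exists>r::'a \<Rightarrow> nat. inj_on r (A - {w}) \<and> (\<forall>a\<in>A - {w}. \<forall>t\<in>S \<union> B. r a < r t) \<and>
           (\<forall>a\<in>A - {w}. clique (later (A - {w} \<union> S \<union> B) r a))"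
    by (rule Suc.hyps(1)[OF c]) (use Suc.prems in \<open>auto elim: no_hole_subset\<close>)
  then obtain r :: "'a \<Rightarrow> nat" where r: "inj_on r (A - {w})" "\<forall>a\<in>A - {w}. \<forall>t\<in>S \<union> B. r a < r t"
           "\<forall>a\<in>A - {w}. clique (later (A - {w} \<union> S \<union> B) r a)" by blast
  \<comment> \<open>The vertex \<open>w\<close> is eliminated before all others, so it takes rank 0
    and the remaining ranks move up by one.\<close>
  define r' where "r' = (\<lambda>a. if a = w then 0 else Suc (r a))"
  have "inj_on r' A"
    using r(1) unfolding r'_def inj_on_def by auto
  moreover have "\<forall>a\<in>A. \<forall>t\<in>S \<union> B. r' a < r' t"
    using r(2) Suc.prems w unfolding r'_def by auto
  moreover have "clique (later (A \<union> S \<union> B) r' a)" if "a \<in> A" for a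
  proof (cases "a = w")
    case True
    have "later (A \<union> S \<union> B) r' w \<subseteq> nb (A \<union> S) w"
      using Suc.prems w unfolding later_def nb_def by auto
    then show ?thesis using w(2) True unfolding simplicial_def by (auto elim: clique_subset)
  next
    case False
    have "later (A \<union> S \<union> B) r' a = later (A - {w} \<union> S \<union> B) r a"
      using False Suc.prems(5,6) w(1) unfolding later_def r'_def by auto
    then show ?thesis using r(3) False that by simp
  qed
  ultimately show ?case by blast
qed

text \<open>Put the eliminated vertices back in reverse order. On its return a vertex has a clique
  as neighbourhood, which cannot meet both sides, so it can join one of them and \<open>S\<close>
  still separates.\<close>

lemma separation_lift:
  assumes "finite V" "T \<subseteq> V" "inj_on r (V - T)" "\<forall>a\<in>V - T. \<forall>t\<in>T. (r a :: nat) < r t"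
    and "\<forall>a\<in>V - T. clique (later V r a)" and "separation T A S B"
  shows "\<exists>A' B'. separation V A' S B' \<and> A \<subseteq> A' \<and> B \<subseteq> B'"
  using assms
proof (induction "card (V - T)" arbitrary: V)
  case 0
  then have "V = T" by auto
  then show ?case using 0 by blast
next
  case (Suc n)
  then have ne: "V - T \<noteq> {}" by auto
  define w where "w = arg_min_on r (V - T)"
  have finVT: "finite (V - T)" using Suc.prems(1) by blast
  have w: "w \<in> V - T" "\<And>a. a \<in> V - T \<Longrightarrow> r w \<le> r a"
    unfolding w_def by (rule arg_min_if_finite(1)[OF finVT ne], rule arg_min_least[OF finVT ne])
  have lw: "nb V w \<subseteq> later V r w"
    using Suc.prems(3,4) w E_irrefl unfolding nb_def later_def inj_on_def
    by (auto) (metis DiffI order_le_less)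
  have "V - {w} - T = V - T - {w}" by blast
  then have "n = card (V - {w} - T)" using Suc.hyps(2) w(1) finVT by simp
  from Suc.hyps(1)[OF this] have "\<exists>A' B'. separation (V - {w}) A' S B' \<and> A \<subseteq> A' \<and> B \<subseteq> B'"
  proof
    show "\<forall>a\<in>V - {w} - T. clique (later (V - {w}) r a)"
    proof
      fix a assume "a \<in> V - {w} - T"
      then have "clique (later V r a)" using Suc.prems(5) by blast
      then show "clique (later (V - {w}) r a)" by (rule clique_subset) (auto simp: later_def)
    qed
  qed (use Suc.prems w in \<open>auto intro: inj_on_subset\<close>)
  then obtain A' B' where s: "separation (V - {w}) A' S B'" "A \<subseteq> A'" "B \<subseteq> B'" by blast
  have cl: "clique (nb V w)" using Suc.prems(5) w(1) lw clique_subset by blast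
  have wV: "w \<in> V" using w by blast
  show ?case
  proof (cases "nb V w \<inter> B' = {}")
    case True
    then have no: "\<not> E w b" if "b \<in> B'" for b
      using that s(1) unfolding separation_def nb_def by blast
    have "separation V (insert w A') S B'"
      using s(1) wV no unfolding separation_def by auto
    then show ?thesis using s by blast
  next
    case False
    have "nb V w \<inter> A' = {}"
    proof (rule ccontr)
      assume "nb V w \<inter> A' \<noteq> {}"
      with False obtain a b where ab: "a \<in> nb V w" "a \<in> A'" "b \<in> nb V w" "b \<in> B'" by blast
      then have "a \<noteq> b" "\<not> E a b" using s(1) unfolding separation_def by auto
      then show False using cl ab unfolding clique_def by blast
    qed
    moreover have "A' \<subseteq> V" using s(1) unfolding separation_def by blast
    ultimately have no: "\<not> E a w" if "a \<in> A'" for a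
      using that E_sym[of a w] unfolding nb_def by auto
    have "separation V A' S (insert w B')"
      using s(1) wV no unfolding separation_def by auto
    then show ?thesis using s by blast
  qed
qed

text \<open>Among the vertices of rank at least \<open>r v\<close>, the later neighbours of
  \<open>v\<close> isolate \<open>v\<close> from the rest, and \<open>z\<close> keeps that rest
  nonempty. Lifting this trivial separation gives one of all of \<open>V\<close>, which is how
  connectivity bounds the size of later neighbourhoods.\<close>

lemma later_separates:
  assumes "finite V" "T \<subseteq> V" "inj_on r (V - T)" "\<forall>a\<in>V - T. \<forall>t\<in>T. (r a :: nat) < r t"
    and "\<forall>a\<in>V - T. clique (later V r a)" and v: "v \<in> V - T"
    and z: "z \<in> V" "r v < r z" "\<not> E v z"
  shows "\<exists>A B. separation V A (later V r v) B"
proof -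
  define T' where "T' = {u \<in> V. r v \<le> r u}"
  have TT: "T \<subseteq> T'" using assms(2,4) v by (auto simp: T'_def less_imp_le)
  have "separation T' {v} (later V r v) (T' - {v} - later V r v)"
    unfolding separation_def
  proof (intro conjI ballI)
    show "T' - {v} - later V r v \<noteq> {}" using z by (auto simp: T'_def later_def)
    show "{v} \<inter> later V r v = {}" by (auto simp: later_def)
    show "T' = {v} \<union> later V r v \<union> (T' - {v} - later V r v)"
      using v by (auto simp: T'_def later_def)
    fix a b assume a: "a \<in> {v}" and b: "b \<in> T' - {v} - later V r v"
    show "\<not> E a b"
    proof
      assume "E a b"
      then have "r b = r v" using a b by (auto simp: T'_def later_def)
      then show False using a b assms(3,4) v unfolding T'_def inj_on_def by force
    qed
  qed auto
  moreover have "inj_on r (V - T')" using assms(3) TT by (auto intro: inj_on_subset)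
  moreover have "\<forall>a\<in>V - T'. \<forall>t\<in>T'. r a < r t" by (auto simp: T'_def)
  moreover have "\<forall>a\<in>V - T'. clique (later V r a)" using assms(5) TT by blast
  moreover have "T' \<subseteq> V" by (auto simp: T'_def)
  ultimately show ?thesis
    using separation_lift[of V T' r "{v}" "later V r v"] assms(1) by blast
qed

section \<open>Exchange of vertices along cliques of size n+1\<close>

text \<open>\<open>F\<close> stands for the possibility of filling the boundary of the simplex on a
  clique, kept abstract so that the argument stays combinatorial. The descent is on the rank of the
  lowest vertex \<open>v\<close> of the clique: if the clique has no common neighbour, one of its
  vertices is exchanged for a vertex ranked below \<open>v\<close>.\<close>

lemma clique_chain_induction:
  fixes F :: "'a set \<Rightarrow> bool"
  assumes fin: "finite V" and hole: "no_hole V" and sep: "separation V A S B"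
    and S: "clique S" "card S = n"
    and min_sep: "\<And>A' S' B'. separation V A' S' B' \<Longrightarrow> n \<le> card S'"
    and degree: "\<And>v. v \<in> A \<Longrightarrow> simplicial V v \<Longrightarrow> n < card (nb V v)"
    and base: "\<And>K w. \<lbrakk>K \<subseteq> A \<union> S; w \<in> V; card K = Suc n; \<forall>u\<in>K. E w u\<rbrakk> \<Longrightarrow> F K"
    and step: "\<And>T u u'. \<lbrakk>T \<subseteq> A \<union> S; u \<in> A \<union> S; u' \<in> A \<union> S; u \<notin> T; u' \<notin> T; u \<noteq> u';
      clique (insert u T); clique (insert u' T); F (insert u' T)\<rbrakk> \<Longrightarrow> F (insert u T)"
  obtains a where "a \<in> A" "\<forall>s\<in>S. E a s" "F (insert a S)"
proof -
  have sp: "V = A \<union> S \<union> B" "A \<noteq> {}" "B \<noteq> {}" "A \<inter> S = {}" "B \<inter> S = {}" "A \<inter> B = {}"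
    "\<forall>a\<in>A. \<forall>b\<in>B. \<not> E a b"
    using sep unfolding separation_def by auto
  have finA: "finite A" and finS: "finite S" using fin sp(1) by auto
  have "\<exists>r::'a \<Rightarrow> nat. inj_on r A \<and> (\<forall>a\<in>A. \<forall>t\<in>S \<union> B. r a < r t) \<and>
           (\<forall>a\<in>A. clique (later (A \<union> S \<union> B) r a))"
  proof (rule elimination_order[OF finA _ finS S(1) sp(4) _ sp(7)])
    show "no_hole (A \<union> S)" by (rule no_hole_subset[OF hole]) (use sp(1) in blast)
    show "B \<inter> (A \<union> S) = {}" using sp(5,6) by blast
  qed
  then obtain r :: "'a \<Rightarrow> nat" where r: "inj_on r A" "\<forall>a\<in>A. \<forall>t\<in>S \<union> B. r a < r t"
      "\<forall>a\<in>A. clique (later V r a)"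
    unfolding sp(1) by blast
  have VSB: "V - (S \<union> B) = A" using sp by blast
  have later_AS: "later V r v \<subseteq> A \<union> S" if "v \<in> A" for v
    using sp(1,7) that unfolding later_def by blast
  \<comment> \<open>Any vertex of \<open>B\<close> is ranked above \<open>v\<close> and not adjacent
    to it, so the later neighbours of \<open>v\<close> form a separator.\<close>
  have later_card: "n \<le> card (later V r v)" if v: "v \<in> A" for v
  proof -
    obtain z where z: "z \<in> B" using sp(3) by blast
    have "\<exists>A B. separation V A (later V r v) B"
      by (rule later_separates[OF fin, of "S \<union> B" r v z]) (use sp r v z VSB in auto)
    then show ?thesis using min_sep by blast
  qed
  have chain: "F K"
    if "clique K" "K \<subseteq> A \<union> S" "card K = Suc n" "v \<in> K" "v \<in> A" "\<forall>u\<in>K. r v \<le> r u" for K v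
    using that
  proof (induction "r v" arbitrary: K v rule: less_induct)
    case less
    show ?case
    proof (cases "\<exists>w\<in>V. \<forall>u\<in>K. E w u")
      case True
      then show ?thesis using base less.prems by blast
    next
      case max: False
      have finK: "finite K" using less.prems(3) card.infinite by fastforce
      have vV: "v \<in> V" using less.prems(5) sp(1) by blast
      \<comment> \<open>The later neighbours of \<open>v\<close> form a clique containing
        \<open>K - {v}\<close>. One outside \<open>K\<close> would therefore be a common neighbour
        of \<open>K\<close>.\<close>
      have later_v: "later V r v \<subseteq> K - {v}"
      proof -
        have K_later: "K - {v} \<subseteq> later V r v"
        proof
          fix u assume u: "u \<in> K - {v}"
          then have "E v u" using less.prems(1,4) unfolding clique_def by (metis DiffE singletonI)
          moreover have "r v \<noteq> r u"
          proof (cases "u \<in> A")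
            case True
            then show ?thesis using r(1) u less.prems(5) by (auto dest: inj_onD)
          next
            case False
            then have "u \<in> S" using u less.prems(2) by blast
            then show ?thesis using r(2) less.prems(5) by fastforce
          qed
          ultimately show "u \<in> later V r v"
            using u less.prems(2,6) sp(1) unfolding later_def by (auto simp: order_less_le)
        qed
        show ?thesis
        proof
          fix w assume w: "w \<in> later V r v"
          show "w \<in> K - {v}"
          proof (rule ccontr)
            assume n: "w \<notin> K - {v}"
            have "E w u" if "u \<in> K" for u
            proof (cases "u = v")
              case True then show ?thesis using w E_sym unfolding later_def by blast
            next
              case False
              then have "u \<in> later V r v" "u \<noteq> w" using K_later that n by auto
              then show ?thesis using r(3) less.prems(5) w unfolding clique_def by metis
            qed
            then show False using max w unfolding later_def by blast
          qed
        qed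
      qed
      \<comment> \<open>Without an earlier neighbour, \<open>v\<close> would be simplicial with its
        neighbourhood inside \<open>K - {v}\<close>, hence of degree at most
        \<open>n\<close>.\<close>
      have "\<exists>w\<in>nb V v. r w < r v"
      proof (rule ccontr)
        assume none: "\<not> ?thesis"
        have "nb V v \<subseteq> later V r v"
        proof
          fix w assume w: "w \<in> nb V v"
          then have "r v \<le> r w" using none by auto
          moreover have "r w \<noteq> r v"
          proof
            assume eq: "r w = r v"
            have "w \<in> A \<union> S" using w sp(1,7) less.prems(5) unfolding nb_def by blast
            then have "w \<in> A" using eq r(2) less.prems(5) by (metis Un_iff less_irrefl)
            then have "w = v" using eq r(1) less.prems(5) by (auto dest: inj_onD)
            then show False using w E_irrefl unfolding nb_def by blast
          qed
          ultimately show "w \<in> later V r v" using w unfolding nb_def later_def by simp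
        qed
        then have sub: "nb V v \<subseteq> K - {v}" using later_v by blast
        have "clique (nb V v)" by (rule clique_subset[OF less.prems(1)]) (use sub in blast)
        then have "n < card (nb V v)" using degree less.prems(5) vV unfolding simplicial_def by blast
        moreover have "card (nb V v) \<le> card (K - {v})" using sub finK by (intro card_mono) auto
        ultimately show False using less.prems(3,4) finK by simp
      qed
      then have ne: "{w \<in> nb V v. r w < r v} \<noteq> {}" by blast
      have finw: "finite {w \<in> nb V v. r w < r v}" using fin unfolding nb_def by auto
      \<comment> \<open>The highest-ranked earlier neighbour is the right choice: a later neighbour
        of \<open>u'\<close> other than \<open>v\<close> is adjacent to \<open>v\<close>, so by
        maximality it is ranked above \<open>v\<close> and lies in \<open>K\<close>.\<close>
      obtain u' where u': "u' \<in> nb V v" "r u' < r v"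
        and u'_max: "\<And>w. w \<in> nb V v \<Longrightarrow> r w < r v \<Longrightarrow> r w \<le> r u'"
      proof -
        have "Max (r ` {w \<in> nb V v. r w < r v}) \<in> r ` {w \<in> nb V v. r w < r v}"
          by (rule Max_in) (use ne finw in auto)
        then obtain u' where "u' \<in> {w \<in> nb V v. r w < r v}" "r u' = Max (r ` {w \<in> nb V v. r w < r v})"
          by auto
        then show ?thesis using that[of u'] finw by auto
      qed
      have u'A: "u' \<in> A"
      proof (rule ccontr)
        assume "u' \<notin> A"
        then have "u' \<in> S \<union> B" using u'(1) sp(1) unfolding nb_def by blast
        then have "r v < r u'" using r(2) less.prems(5) by blast
        then show False using u'(2) by simp
      qed
      have v_later: "v \<in> later V r u'"
        using u' vV E_sym unfolding nb_def later_def by blast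
      have sub: "later V r u' \<subseteq> K"
      proof
        fix w assume w: "w \<in> later V r u'"
        show "w \<in> K"
        proof (cases "w = v")
          case True then show ?thesis using less.prems(4) by simp
        next
          case False
          then have "E v w" using r(3) u'A w v_later unfolding clique_def by metis
          then have wn: "w \<in> nb V v" using w unfolding nb_def later_def by blast
          have "\<not> r w < r v" using u'_max[OF wn] w unfolding later_def by auto
          moreover have "r w \<noteq> r v"
          proof
            assume eq: "r w = r v"
            have "w \<in> A" using eq r(2) less.prems(5) later_AS[OF u'A] w by (metis Un_iff less_irrefl subsetD)
            then show False using eq r(1) less.prems(5) False by (auto dest: inj_onD)
          qed
          ultimately have "w \<in> later V r v" using wn unfolding later_def nb_def by simp
          then show ?thesis using later_v by blast
        qed
      qed
      \<comment> \<open>As \<open>u'\<close> is no common neighbour of \<open>K\<close>, its later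
        neighbours form a proper subset of \<open>K\<close>. They number at least \<open>n\<close>,
        so exactly one vertex \<open>t\<close> is missing, and \<open>u'\<close> can replace
        it.\<close>
      have "later V r u' \<noteq> K" using max u'A sp(1) unfolding later_def by blast
      then obtain t where t: "t \<in> K" "t \<notin> later V r u'" using sub by blast
      have eqK: "later V r u' = K - {t}"
      proof (rule card_seteq)
        show "later V r u' \<subseteq> K - {t}" using sub t by blast
        show "card (K - {t}) \<le> card (later V r u')" using later_card[OF u'A] less.prems(3) t finK by simp
      qed (use finK in simp)
      define T where "T = K - {t}"
      have u'K: "u' \<notin> K" using less.prems(6) u'(2) by auto
      have K': "insert t T = K" using t by (auto simp: T_def)
      have Tadj: "\<forall>u\<in>T. E u' u" using eqK unfolding T_def later_def by auto
      have clT: "clique T" by (rule clique_subset[OF less.prems(1)]) (auto simp: T_def)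
      have cl': "clique (insert u' T)" by (rule clique_insert[OF clT Tadj])
      have "F (insert u' T)"
      proof (rule less.hyps[OF u'(2) cl'])
        show "insert u' T \<subseteq> A \<union> S" using less.prems(2) u'A by (auto simp: T_def)
        show "card (insert u' T) = Suc n" using u'K less.prems(3) t finK by (simp add: T_def)
        show "\<forall>u\<in>insert u' T. r u' \<le> r u" using u'(2) less.prems(6) by (auto simp: T_def)
      qed (use u'A in auto)
      then have "F (insert t T)"
        using step[of T t u'] cl' K' less.prems(1,2) u'A u'K t by (auto simp: T_def)
      then show ?thesis using K' by simp
    qed
  qed
  \<comment> \<open>For the last vertex of \<open>A\<close> in the order, the later neighbours lie
    in \<open>S\<close> and number at least \<open>n = card S\<close>. Thus \<open>a\<close> is
    adjacent to all of \<open>S\<close>.\<close>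
  obtain a where a: "a \<in> A" "\<And>w. w \<in> A \<Longrightarrow> r w \<le> r a"
  proof -
    have "Max (r ` A) \<in> r ` A" by (rule Max_in) (use finA sp(2) in auto)
    then obtain a where "a \<in> A" "r a = Max (r ` A)" by auto
    then show ?thesis using that[of a] finA by auto
  qed
  have "later V r a \<subseteq> S"
    using later_AS[OF a(1)] a(2) unfolding later_def by fastforce
  then have eq: "later V r a = S"
    by (intro card_seteq[OF finS]) (use later_card[OF a(1)] S(2) in auto)
  then have adj: "\<forall>s\<in>S. E a s" unfolding later_def by blast
  moreover have "F (insert a S)"
  proof (rule chain[of _ a])
    show "clique (insert a S)" by (rule clique_insert[OF S(1) adj])
    show "card (insert a S) = Suc n" using S(2) finS a(1) sp(4) by (subst card_insert_disjoint) auto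
    show "\<forall>u\<in>insert a S. r a \<le> r u" using r(2) a(1) by (auto simp: less_imp_le)
  qed (use a(1) in auto)
  ultimately show ?thesis using that a(1) by blast
qed

section \<open>Menger's theorem in terms of clique separators\<close>

definition path :: "'a set \<Rightarrow> 'a list \<Rightarrow> 'a \<Rightarrow> 'a \<Rightarrow> bool" where
  "path V p x y \<longleftrightarrow> p \<noteq> [] \<and> hd p = x \<and> last p = y \<and> distinct p \<and> set p \<subseteq> V \<and> successively E p"

lemma path_Cons: "path V p u y \<Longrightarrow> x \<in> V \<Longrightarrow> E x u \<Longrightarrow> x \<notin> set p \<Longrightarrow> path V (x # p) x y"
  unfolding path_def by (cases p) auto

text \<open>
  Tokens on \<open>F\<close> are moved in elimination order: fewer than \<open>k\<close> of the later neighbours of the vertex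
  being eliminated are occupied by the other tokens, so its own token can move on, unless it can
  step to \<open>y\<close> directly.
\<close>

lemma disjoint_fan:
  fixes r :: "'a \<Rightarrow> nat"
  assumes fin: "finite V" and inj: "inj_on r (V - {y})" and y: "y \<in> V" "\<And>a. a \<in> V - {y} \<Longrightarrow> r a < r y"
    and many: "\<And>v. v \<in> V - {y} \<Longrightarrow> \<not> E v y \<Longrightarrow> k \<le> card (later V r v)"
    and F: "F \<subseteq> V - {y}" "card F \<le> k" "\<forall>f\<in>F. m \<le> r f"
  shows "\<exists>P. (\<forall>f\<in>F. path V (P f) f y \<and> (\<forall>w\<in>set (P f). m \<le> r w)) \<and>
             (\<forall>f\<in>F. \<forall>g\<in>F. f \<noteq> g \<longrightarrow> set (P f) \<inter> set (P g) = {y})"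
  using F
proof (induction "card {w\<in>V. m \<le> r w}" arbitrary: F m rule: less_induct)
  case less
  show ?case
  proof (cases "F = {}")
    case True then show ?thesis by simp
  next
    case False
    have finF: "finite F" using less.prems(1) fin finite_subset by blast
    obtain v where v: "v \<in> F" "\<And>f. f \<in> F \<Longrightarrow> r v \<le> r f"
    proof -
      have "Min (r ` F) \<in> r ` F" by (rule Min_in) (use finF False in auto)
      then obtain v where "v \<in> F" "r v = Min (r ` F)" by auto
      then show ?thesis using that[of v] finF by auto
    qed
    have vV: "v \<in> V" "v \<noteq> y" using v(1) less.prems(1) by auto
    have mv: "m \<le> r v" using less.prems(3) v(1) by blast
    have small: "card {w\<in>V. Suc (r v) \<le> r w} < card {w\<in>V. m \<le> r w}"
    proof (rule psubset_card_mono)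
      have "v \<in> {w\<in>V. m \<le> r w}" "v \<notin> {w\<in>V. Suc (r v) \<le> r w}" using vV mv by auto
      moreover have "{w\<in>V. Suc (r v) \<le> r w} \<subseteq> {w\<in>V. m \<le> r w}" using mv by auto
      ultimately show "{w\<in>V. Suc (r v) \<le> r w} \<subset> {w\<in>V. m \<le> r w}" by blast
    qed (use fin in auto)
    have rest: "Suc (r v) \<le> r f" if "f \<in> F - {v}" for f
    proof -
      have "r f \<noteq> r v" using inj that v(1) less.prems(1) by (auto dest: inj_onD)
      then show ?thesis using v(2)[of f] that by auto
    qed
    \<comment> \<open>The paths already found stay at ranks above \<open>r v\<close>, so none of
      them contains \<open>v\<close>, and \<open>v\<close> may be put in front of one of
      them.\<close>
    have extend: ?thesis
      if P: "\<forall>f\<in>F'. path V (P f) f y \<and> (\<forall>w\<in>set (P f). Suc (r v) \<le> r w)"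
        "\<forall>f\<in>F'. \<forall>g\<in>F'. f \<noteq> g \<longrightarrow> set (P f) \<inter> set (P g) = {y}"
        and F': "F - {v} \<subseteq> F'" and q: "path V (v # q) v y" "y \<in> set q"
        "\<forall>w\<in>set q. Suc (r v) \<le> r w" "\<forall>f\<in>F - {v}. set q \<inter> set (P f) = {y}" for P F' q
    proof (intro exI[of _ "P(v := v # q)"] conjI ballI impI)
      fix f assume f: "f \<in> F"
      show "path V ((P(v := v # q)) f) f y" using P(1) F' q f by auto
      fix w assume w: "w \<in> set ((P(v := v # q)) f)"
      show "m \<le> r w"
      proof (cases "f = v")
        case True
        then show ?thesis using w q(3) mv by auto
      next
        case False
        then have "Suc (r v) \<le> r w" using P(1) F' f w by auto
        then show ?thesis using mv by simp
      qed
    next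
      fix f g assume fg: "f \<in> F" "g \<in> F" "f \<noteq> g"
      have v_notin: "v \<notin> set (P h)" if "h \<in> F - {v}" for h
        using P(1) F' that by fastforce
      show "set ((P(v := v # q)) f) \<inter> set ((P(v := v # q)) g) = {y}"
      proof (cases "f = v \<or> g = v")
        case True
        then show ?thesis using fg q(4) v_notin by auto
      next
        case False
        then have "f \<in> F'" "g \<in> F'" using fg F' by auto
        then show ?thesis using fg(3) P(2) False by simp
      qed
    qed
    show ?thesis
    proof (cases "E v y")
      case True
      have "\<exists>P. (\<forall>f\<in>F - {v}. path V (P f) f y \<and> (\<forall>w\<in>set (P f). Suc (r v) \<le> r w)) \<and>
             (\<forall>f\<in>F - {v}. \<forall>g\<in>F - {v}. f \<noteq> g \<longrightarrow> set (P f) \<inter> set (P g) = {y})"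
      proof (rule less.hyps[OF small])
        show "F - {v} \<subseteq> V - {y}" using less.prems(1) by blast
        show "card (F - {v}) \<le> k" using less.prems(2) card_mono[OF finF, of "F - {v}"] by auto
        show "\<forall>f\<in>F - {v}. Suc (r v) \<le> r f" using rest by blast
      qed
      then obtain P where P: "\<forall>f\<in>F - {v}. path V (P f) f y \<and> (\<forall>w\<in>set (P f). Suc (r v) \<le> r w)"
             "\<forall>f\<in>F - {v}. \<forall>g\<in>F - {v}. f \<noteq> g \<longrightarrow> set (P f) \<inter> set (P g) = {y}" by (elim exE conjE)
      show ?thesis
      proof (rule extend[OF P, of "[y]"])
        show "path V [v, y] v y" using vV y(1) True unfolding path_def by auto
        show "\<forall>w\<in>set [y]. Suc (r v) \<le> r w" using y(2)[of v] vV by simp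
        have "y \<in> set (P f)" if "f \<in> F - {v}" for f
          using P(1) that unfolding path_def by (metis last_in_set)
        then show "\<forall>f\<in>F - {v}. set [y] \<inter> set (P f) = {y}" by auto
      qed auto
    next
      case False
      have "card (F - {v}) < card (later V r v)"
        using many[of v] vV False less.prems(2) finF v(1) card_Diff1_less[OF finF v(1)] by simp
      then have "\<not> later V r v \<subseteq> F - {v}"
        using card_mono[of "F - {v}" "later V r v"] finF by auto
      then obtain u where u: "u \<in> later V r v" "u \<notin> F - {v}" by blast
      have uV: "u \<in> V" "u \<noteq> y" "E v u" "Suc (r v) \<le> r u" using u(1) False unfolding later_def by auto
      have "\<exists>P. (\<forall>f\<in>insert u (F - {v}). path V (P f) f y \<and> (\<forall>w\<in>set (P f). Suc (r v) \<le> r w)) \<and>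
             (\<forall>f\<in>insert u (F - {v}). \<forall>g\<in>insert u (F - {v}). f \<noteq> g \<longrightarrow> set (P f) \<inter> set (P g) = {y})"
      proof (rule less.hyps[OF small])
        show "insert u (F - {v}) \<subseteq> V - {y}" using less.prems(1) uV by blast
        have "card (insert u (F - {v})) = card F"
          using u(2) finF v(1) card.remove[OF finF v(1)] by simp
        then show "card (insert u (F - {v})) \<le> k" using less.prems(2) by simp
        show "\<forall>f\<in>insert u (F - {v}). Suc (r v) \<le> r f" using rest uV by blast
      qed
      then obtain P where P: "\<forall>f\<in>insert u (F - {v}). path V (P f) f y \<and> (\<forall>w\<in>set (P f). Suc (r v) \<le> r w)"
             "\<forall>f\<in>insert u (F - {v}). \<forall>g\<in>insert u (F - {v}). f \<noteq> g \<longrightarrow> set (P f) \<inter> set (P g) = {y}" by (elim exE conjE)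
      have Pu: "path V (P u) u y" "\<forall>w\<in>set (P u). Suc (r v) \<le> r w" using P(1) by auto
      show ?thesis
      proof (rule extend[OF P, of "P u"])
        show "path V (v # P u) v y"
          by (rule path_Cons[OF Pu(1) vV(1) uV(3)]) (use Pu(2) in fastforce)
        show "y \<in> set (P u)" using Pu(1) unfolding path_def by (metis last_in_set)
        show "\<forall>f\<in>F - {v}. set (P u) \<inter> set (P f) = {y}" using P(2) u(2) by (metis insertCI)
      qed (use Pu in auto)
    qed
  qed
qed

text \<open>For non-adjacent \<open>x\<close> and \<open>y\<close>, eliminate towards
  \<open>y\<close>: the later neighbours of \<open>x\<close> form a clique separator, so
  \<open>k\<close> of them are available to start a fan. For adjacent \<open>x\<close> and
  \<open>y\<close>, a largest clique containing both already provides enough paths. The excluded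
  case of a clique with at most \<open>k\<close> vertices has no separator that could account for
  the missing paths.\<close>

lemma disjoint_paths:
  assumes fin: "finite V" and hole: "no_hole V"
    and min_sep: "\<And>A S B. separation V A S B \<Longrightarrow> clique S \<Longrightarrow> k \<le> card S"
    and not_small: "\<not> (clique V \<and> card V \<le> k)" and xy: "x \<in> V" "y \<in> V" "x \<noteq> y"
  shows "\<exists>P. finite P \<and> k \<le> card P \<and> (\<forall>p\<in>P. path V p x y) \<and>
     (\<forall>p\<in>P. \<forall>q\<in>P. p \<noteq> q \<longrightarrow> set p \<inter> set q = {x, y})"
proof (cases "E x y")
  case False
  have "\<exists>r::'a \<Rightarrow> nat. inj_on r (V - {y}) \<and> (\<forall>a\<in>V - {y}. \<forall>t\<in>{y} \<union> {}. r a < r t) \<and>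
           (\<forall>a\<in>V - {y}. clique (later (V - {y} \<union> {y} \<union> {}) r a))"
    by (rule elimination_order) (use fin hole xy in \<open>auto simp: clique_def insert_absorb\<close>)
  moreover have "V - {y} \<union> {y} \<union> {} = V" using xy by blast
  ultimately obtain r :: "'a \<Rightarrow> nat" where r: "inj_on r (V - {y})" "\<And>a. a \<in> V - {y} \<Longrightarrow> r a < r y"
           "\<forall>a\<in>V - {y}. clique (later V r a)" by auto
  have many: "k \<le> card (later V r v)" if "v \<in> V - {y}" "\<not> E v y" for v
  proof -
    have "\<exists>A B. separation V A (later V r v) B"
      by (rule later_separates[OF fin, of "{y}" r v y]) (use r xy that in auto)
    then show ?thesis using min_sep r(3) that by blast
  qed
  have "k \<le> card (later V r x)" using many xy False by blast
  then obtain F where F: "F \<subseteq> later V r x" "card F = k" "finite F" using obtain_subset_with_card_n by metis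
  have "\<exists>P. (\<forall>f\<in>F. path V (P f) f y \<and> (\<forall>w\<in>set (P f). Suc (r x) \<le> r w)) \<and>
             (\<forall>f\<in>F. \<forall>g\<in>F. f \<noteq> g \<longrightarrow> set (P f) \<inter> set (P g) = {y})"
  proof (rule disjoint_fan[OF fin r(1) xy(2) r(2) many])
    show "F \<subseteq> V - {y}" "\<forall>f\<in>F. Suc (r x) \<le> r f" using F(1) False unfolding later_def by auto
  qed (use F in auto)
  then obtain P where P: "\<forall>f\<in>F. path V (P f) f y \<and> (\<forall>w\<in>set (P f). Suc (r x) \<le> r w)"
             "\<forall>f\<in>F. \<forall>g\<in>F. f \<noteq> g \<longrightarrow> set (P f) \<inter> set (P g) = {y}" by (elim exE conjE)
  have xP: "x \<notin> set (P f)" if "f \<in> F" for f using P(1) that by fastforce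
  have "inj_on (\<lambda>f. x # P f) F" using P(1) unfolding path_def inj_on_def by (metis list.inject)
  then have "card ((\<lambda>f. x # P f) ` F) = k" using F(2) card_image by blast
  moreover have "path V p x y" if p: "p \<in> (\<lambda>f. x # P f) ` F" for p
  proof -
    obtain f where f: "f \<in> F" "p = x # P f" using p by blast
    have "E x f" using F(1) f unfolding later_def by blast
    then show ?thesis using path_Cons[of V "P f" f y x] P(1) f xP xy(1) by blast
  qed
  moreover have "set p \<inter> set q = {x, y}"
    if pq: "p \<in> (\<lambda>f. x # P f) ` F" "q \<in> (\<lambda>f. x # P f) ` F" "p \<noteq> q" for p q
  proof -
    obtain f g where fg: "f \<in> F" "p = x # P f" "g \<in> F" "q = x # P g" using pq(1,2) by blast
    then have "f \<noteq> g" using pq(3) by blast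
    then have "set (P f) \<inter> set (P g) = {y}" using P(2) fg by blast
    then show ?thesis using fg xP by auto
  qed
  ultimately show ?thesis using F(3) by (intro exI[of _ "(\<lambda>f. x # P f) ` F"]) auto
next
  case True
  define Q where "Q = {K. K \<subseteq> V \<and> clique K \<and> x \<in> K \<and> y \<in> K}"
  have finQ: "finite Q" unfolding Q_def using fin by auto
  have "{x, y} \<in> Q" using xy True E_sym unfolding Q_def clique_def by blast
  then obtain K where K: "K \<in> Q" "\<And>L. L \<in> Q \<Longrightarrow> card L \<le> card K"
  proof -
    assume a: "\<And>K. K \<in> Q \<Longrightarrow> (\<And>L. L \<in> Q \<Longrightarrow> card L \<le> card K) \<Longrightarrow> thesis" and ne: "{x, y} \<in> Q"
    have "Max (card ` Q) \<in> card ` Q" by (rule Max_in) (use finQ ne in auto)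
    then obtain K where "K \<in> Q" "card K = Max (card ` Q)" by auto
    then show thesis using a[of K] finQ by auto
  qed
  have KV: "K \<subseteq> V" "clique K" "x \<in> K" "y \<in> K" using K(1) unfolding Q_def by auto
  have finK: "finite K" using KV(1) fin finite_subset by blast
  \<comment> \<open>Otherwise eliminate everything outside \<open>K\<close>. The last vertex
    \<open>v\<close> has all its later neighbours in \<open>K\<close> but, by maximality of
    \<open>K\<close>, misses some \<open>z\<close> in \<open>K\<close>. These neighbours then
    separate while numbering fewer than \<open>card K\<close>, which is at most
    \<open>k\<close>.\<close>
  have "Suc k \<le> card K"
  proof (rule ccontr)
    assume "\<not> Suc k \<le> card K"
    then have kK: "card K \<le> k" by simp
    then have "V - K \<noteq> {}" using not_small KV by auto
    have "\<exists>r::'a \<Rightarrow> nat. inj_on r (V - K) \<and> (\<forall>a\<in>V - K. \<forall>t\<in>K \<union> {}. r a < r t) \<and>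
           (\<forall>a\<in>V - K. clique (later (V - K \<union> K \<union> {}) r a))"
      by (rule elimination_order) (use fin hole KV finK in \<open>auto simp: Un_absorb2\<close>)
    moreover have "V - K \<union> K \<union> {} = V" using KV by blast
    ultimately obtain r :: "'a \<Rightarrow> nat" where r: "inj_on r (V - K)" "\<forall>a\<in>V - K. \<forall>t\<in>K. r a < r t"
           "\<forall>a\<in>V - K. clique (later V r a)" by auto
    obtain v where v: "v \<in> V - K" "\<And>w. w \<in> V - K \<Longrightarrow> r w \<le> r v"
    proof -
      have "Max (r ` (V - K)) \<in> r ` (V - K)" by (rule Max_in) (use fin \<open>V - K \<noteq> {}\<close> in auto)
      then obtain v where "v \<in> V - K" "r v = Max (r ` (V - K))" by auto
      then show ?thesis using that[of v] fin by auto
    qed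
    have sub: "later V r v \<subseteq> K"
    proof
      fix w assume w: "w \<in> later V r v"
      then show "w \<in> K" using v(2)[of w] unfolding later_def by (cases "w \<in> K") auto
    qed
    have "\<exists>z\<in>K. \<not> E v z"
    proof (rule ccontr)
      assume "\<not> (\<exists>z\<in>K. \<not> E v z)"
      then have "clique (insert v K)" by (intro clique_insert[OF KV(2)]) blast
      then have "insert v K \<in> Q" using KV v(1) unfolding Q_def by auto
      then show False using K(2)[of "insert v K"] finK v(1) by auto
    qed
    then obtain z where z: "z \<in> K" "\<not> E v z" by blast
    have "r v < r z" using r(2) v(1) z(1) by blast
    then have "\<exists>A B. separation V A (later V r v) B"
      by (intro later_separates[OF fin KV(1) r(1,2,3) v(1) _ _ z(2)]) (use KV(1) z(1) in auto)
    then have "k \<le> card (later V r v)" using min_sep r(3) v(1) by blast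
    moreover have "later V r v \<subset> K" using sub z unfolding later_def by auto
    then have "card (later V r v) < card K" by (rule psubset_card_mono[OF finK])
    ultimately show False using kK by linarith
  qed
  \<comment> \<open>The edge and the detours through the other vertices of \<open>K\<close> give
    \<open>card K - 1\<close> paths.\<close>
  define P where "P = insert [x, y] ((\<lambda>z. [x, z, y]) ` (K - {x, y}))"
  have "card (K - {x, y}) = card K - 2"
    using KV xy(3) finK by (simp add: card_Diff_subset)
  moreover have "card ((\<lambda>z. [x, z, y]) ` (K - {x, y})) = card (K - {x, y})"
    by (intro card_image) (auto simp: inj_on_def)
  moreover have "[x, y] \<notin> (\<lambda>z. [x, z, y]) ` (K - {x, y})" by auto
  ultimately have "k \<le> card P"
    using \<open>Suc k \<le> card K\<close> finK unfolding P_def by simp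
  moreover have "finite P" using finK unfolding P_def by simp
  moreover have "\<forall>p\<in>P. path V p x y"
    using True xy KV(1-4) unfolding P_def path_def clique_def by auto
  moreover have "\<forall>p\<in>P. \<forall>q\<in>P. p \<noteq> q \<longrightarrow> set p \<inter> set q = {x, y}"
    unfolding P_def by auto
  ultimately show ?thesis by blast
qed

end
section \<open>Maps into geometric realizations\<close>

definition full_simplex :: "'a set \<Rightarrow> ('a \<Rightarrow> real) set" where
  "full_simplex D = {x. (\<forall>v. 0 \<le> x v) \<and> (\<forall>v. v \<notin> D \<longrightarrow> x v = 0) \<and> sum x D = 1}"

definition simplex_bd :: "'a set \<Rightarrow> ('a \<Rightarrow> real) set" where
  "simplex_bd D = {x \<in> full_simplex D. \<exists>d\<in>D. x d = 0}"

definition realization :: "'a set set \<Rightarrow> ('a \<Rightarrow> real) set" where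
  "realization K = {f. (\<forall>v. 0 \<le> f v) \<and> {v. f v \<noteq> 0} \<in> K \<and> (\<Sum>v\<in>{v. f v \<noteq> 0}. f v) = 1}"

lemma geometric_realization_eq: "geometric_realization K = top_of_set (realization K)"
  unfolding geometric_realization_def realization_def euclidean_product_topology ..

lemma realization_mono: "K \<subseteq> L \<Longrightarrow> realization K \<subseteq> realization L"
  unfolding realization_def by blast

lemma realizationI:
  assumes "x \<in> full_simplex D" "finite D" "{v. x v \<noteq> 0} \<in> K"
  shows "x \<in> realization K"
proof -
  have "(\<Sum>v\<in>{v. x v \<noteq> 0}. x v) = sum x D"
    by (rule sum.mono_neutral_left) (use assms in \<open>auto simp: full_simplex_def\<close>)
  then show ?thesis using assms unfolding full_simplex_def realization_def by auto
qed

lemma realization_sum: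
  assumes "x \<in> realization K" "{v. x v \<noteq> 0} \<subseteq> V" "finite V"
  shows "sum x V = 1"
proof -
  have "(\<Sum>v\<in>{v. x v \<noteq> 0}. x v) = sum x V"
    by (rule sum.mono_neutral_left) (use assms in auto)
  then show ?thesis using assms(1) unfolding realization_def by auto
qed

lemma continuous_on_coordinate [continuous_intros]:
  "continuous_on S (\<lambda>x. x i)" for S :: "('a \<Rightarrow> real) set"
  by (rule continuous_on_subset[OF continuous_on_product_coordinates]) simp

lemma continuous_on_Min_image:
  fixes f :: "'i \<Rightarrow> 'b::topological_space \<Rightarrow> real"
  assumes "finite I" "I \<noteq> {}" "\<And>i. i \<in> I \<Longrightarrow> continuous_on S (f i)"
  shows "continuous_on S (\<lambda>x. Min ((\<lambda>i. f i x) ` I))"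
  using assms
proof (induction I rule: finite_ne_induct)
  case (insert i I)
  have "continuous_on S (\<lambda>x. min (f i x) (Min ((\<lambda>i. f i x) ` I)))"
    by (intro continuous_on_min) (use insert in auto)
  then show ?case using insert by simp
qed simp

section \<open>Spheres as boundaries of simplices, and the obstruction to connectedness\<close>

definition unit_sphere :: "nat \<Rightarrow> (nat \<Rightarrow> real) set" where
  "unit_sphere m = {x. (\<Sum>i\<le>m. x i ^ 2) = 1 \<and> (\<forall>i>m. x i = 0)}"

lemma nsphere_eq: "nsphere m = top_of_set (unit_sphere m)"
  unfolding nsphere unit_sphere_def euclidean_product_topology ..

lemma nball_eq: "nball (Suc m) = top_of_set {x. (\<Sum>i\<le>m. x i ^ 2) \<le> 1 \<and> (\<forall>i>m. x i = 0)}"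
  unfolding nball_def Euclidean_space_def euclidean_product_topology subtopology_subtopology
  by (rule arg_cong[where f = top_of_set]) (auto simp: lessThan_Suc_atMost Suc_le_eq)

text \<open>Both sets represent the rays of an (m+2)-dimensional space modulo its diagonal. On the
  sphere the last coordinate is 0 and the Euclidean norm is 1; on the boundary of the simplex the
  least coordinate is 0 and the sum is 1. \<open>\<psi>\<close> and \<open>\<zeta>\<close> pass
  between these normalisations.\<close>

lemma simplex_bd_sphere:
  fixes D :: "'a set"
  assumes D: "finite D" "card D = m + 2"
  obtains \<psi> :: "(nat \<Rightarrow> real) \<Rightarrow> 'a \<Rightarrow> real" and \<zeta> :: "('a \<Rightarrow> real) \<Rightarrow> nat \<Rightarrow> real"
  where "continuous_on (unit_sphere m) \<psi>" "\<psi> \<in> unit_sphere m \<rightarrow> simplex_bd D"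
    "continuous_on (simplex_bd D) \<zeta>" "\<zeta> \<in> simplex_bd D \<rightarrow> unit_sphere m"
    "\<And>u. u \<in> unit_sphere m \<Longrightarrow> \<zeta> (\<psi> u) = u"
proof -
  obtain e where e: "bij_betw e {..Suc m} D"
    using bij_betw_from_nat_into_finite[OF D(1)] D(2) by (metis Suc_eq_plus1 add_2_eq_Suc' lessThan_Suc_atMost add_Suc_right numeral_2_eq_2)
  define idx where "idx = inv_into {..Suc m} e"
  have idx: "idx v \<le> Suc m" "e (idx v) = v" if "v \<in> D" for v
    using that e unfolding idx_def bij_betw_def
    by (metis atMost_iff inv_into_into, metis f_inv_into_f)
  have idx_e: "idx (e i) = i" "e i \<in> D" if "i \<le> Suc m" for i
    using that e unfolding idx_def bij_betw_def by (auto simp: inv_into_f_f)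
  define \<mu> where "\<mu> u = Min (u ` {..Suc m})" for u :: "nat \<Rightarrow> real"
  define \<sigma> where "\<sigma> u = (\<Sum>i\<le>Suc m. u i - \<mu> u)" for u :: "nat \<Rightarrow> real"
  define \<psi> where "\<psi> u = (\<lambda>v. if v \<in> D then (u (idx v) - \<mu> u) / \<sigma> u else 0)" for u
  define N where "N y = sqrt (\<Sum>i\<le>m. (y (e i) - y (e (Suc m))) ^ 2)" for y :: "'a \<Rightarrow> real"
  define \<zeta> where "\<zeta> y = (\<lambda>i. if i \<le> m then (y (e i) - y (e (Suc m))) / N y else 0)" for y
  have \<mu>_le: "\<mu> u \<le> u i" if "i \<le> Suc m" for u i
    unfolding \<mu>_def using that by (intro Min_le) auto
  have \<mu>_ex: "\<exists>i\<le>Suc m. u i = \<mu> u" for u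
  proof -
    have "\<mu> u \<in> u ` {..Suc m}" unfolding \<mu>_def by (intro Min_in) auto
    then show ?thesis by auto
  qed
  have \<mu>_cont: "continuous_on S \<mu>" for S
    unfolding \<mu>_def by (intro continuous_on_Min_image continuous_on_coordinate) auto
  have \<sigma>_pos: "\<sigma> u > 0" if u: "u \<in> unit_sphere m" for u
  proof (rule ccontr)
    assume "\<not> \<sigma> u > 0"
    moreover have "\<sigma> u \<ge> 0" unfolding \<sigma>_def by (intro sum_nonneg) (use \<mu>_le in auto)
    ultimately have "\<sigma> u = 0" by simp
    then have "\<forall>i\<in>{..Suc m}. u i - \<mu> u = 0"
      unfolding \<sigma>_def by (subst (asm) sum_nonneg_eq_0_iff) (use \<mu>_le in auto)
    moreover have "u (Suc m) = 0" using u unfolding unit_sphere_def by simp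
    ultimately have "\<forall>i\<le>m. u i = 0" by auto
    then show False using u unfolding unit_sphere_def by simp
  qed
  have sum_D: "sum h D = (\<Sum>i\<le>Suc m. h (e i))" for h :: "'a \<Rightarrow> real"
    using sum.reindex_bij_betw[OF e, of h] by simp
  have \<psi>_e: "\<psi> u (e i) = (u i - \<mu> u) / \<sigma> u" if "i \<le> Suc m" for u i
    using idx_e that by (simp add: \<psi>_def)
  have \<psi>_bd: "\<psi> u \<in> simplex_bd D" if u: "u \<in> unit_sphere m" for u
  proof -
    have "sum (\<psi> u) D = (\<Sum>i\<le>Suc m. (u i - \<mu> u) / \<sigma> u)"
      unfolding sum_D using \<psi>_e by (intro sum.cong) auto
    also have "\<dots> = 1"
      unfolding sum_divide_distrib[symmetric] \<sigma>_def[symmetric] using \<sigma>_pos[OF u] by simp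
    finally have "sum (\<psi> u) D = 1" .
    moreover obtain i where "i \<le> Suc m" "u i = \<mu> u" using \<mu>_ex by blast
    then have "\<exists>d\<in>D. \<psi> u d = 0" using \<psi>_e[of i u] idx_e by (intro bexI[of _ "e i"]) auto
    moreover have "0 \<le> \<psi> u v" for v
      using idx(1) \<mu>_le \<sigma>_pos[OF u] by (simp add: \<psi>_def)
    ultimately show ?thesis
      unfolding simplex_bd_def full_simplex_def by (simp add: \<psi>_def)
  qed
  have N_pos: "N y > 0" if y: "y \<in> simplex_bd D" for y
  proof (rule ccontr)
    assume "\<not> N y > 0"
    moreover have "N y \<ge> 0" unfolding N_def by (intro real_sqrt_ge_zero sum_nonneg) auto
    ultimately have "N y = 0" by simp
    then have "(\<Sum>i\<le>m. (y (e i) - y (e (Suc m))) ^ 2) = 0" unfolding N_def by simp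
    then have "\<forall>i\<in>{..m}. (y (e i) - y (e (Suc m))) ^ 2 = 0"
      by (subst (asm) sum_nonneg_eq_0_iff) auto
    then have const: "y (e i) = y (e (Suc m))" if "i \<le> Suc m" for i
      using that by (cases "i = Suc m") auto
    obtain d where d: "d \<in> D" "y d = 0" using y unfolding simplex_bd_def by blast
    have last: "y (e (Suc m)) = 0" using const[OF idx(1)[OF d(1)]] idx(2)[OF d(1)] d(2) by simp
    have "y (e i) = 0" if "i \<le> Suc m" for i using const[OF that] last by simp
    then have "sum y D = 0" unfolding sum_D by simp
    then show False using y unfolding simplex_bd_def full_simplex_def by simp
  qed
  have \<zeta>_sphere: "\<zeta> y \<in> unit_sphere m" if y: "y \<in> simplex_bd D" for y
  proof -
    have "(\<Sum>i\<le>m. \<zeta> y i ^ 2) = (\<Sum>i\<le>m. (y (e i) - y (e (Suc m))) ^ 2) / N y ^ 2"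
      unfolding sum_divide_distrib by (intro sum.cong) (auto simp: \<zeta>_def power_divide)
    also have "\<dots> = N y ^ 2 / N y ^ 2"
      unfolding N_def by (subst (2) real_sqrt_pow2) (auto intro: sum_nonneg)
    also have "\<dots> = 1" using N_pos[OF y] by simp
    finally show ?thesis unfolding unit_sphere_def by (simp add: \<zeta>_def)
  qed
  have inv: "\<zeta> (\<psi> u) = u" if u: "u \<in> unit_sphere m" for u
  proof -
    have u0: "u i = 0" if "i > m" for i using u that unfolding unit_sphere_def by simp
    have diff: "\<psi> u (e i) - \<psi> u (e (Suc m)) = u i / \<sigma> u" if "i \<le> m" for i
      using that u0[of "Suc m"] by (simp add: \<psi>_e diff_divide_distrib)
    have "N (\<psi> u) = sqrt (\<Sum>i\<le>m. (u i / \<sigma> u) ^ 2)"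
      unfolding N_def using diff by simp
    also have "\<dots> = sqrt ((\<Sum>i\<le>m. u i ^ 2) / \<sigma> u ^ 2)"
      by (simp add: power_divide sum_divide_distrib)
    also have "\<dots> = 1 / \<sigma> u"
      using u \<sigma>_pos[OF u] unfolding unit_sphere_def by (simp add: real_sqrt_divide)
    finally have "N (\<psi> u) = 1 / \<sigma> u" .
    then show ?thesis
      using diff u0 \<sigma>_pos[OF u] by (auto simp: \<zeta>_def fun_eq_iff)
  qed
  show ?thesis
  proof (rule that[of \<psi> \<zeta>])
    show "continuous_on (unit_sphere m) \<psi>"
    proof (rule continuous_on_coordinatewise_then_product)
      fix v
      show "continuous_on (unit_sphere m) (\<lambda>u. \<psi> u v)"
      proof (cases "v \<in> D")
        case True
        have "continuous_on (unit_sphere m) (\<lambda>u. (u (idx v) - \<mu> u) / \<sigma> u)"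
          unfolding \<sigma>_def
          by (intro continuous_intros \<mu>_cont) (use \<sigma>_pos in \<open>force simp: \<sigma>_def\<close>)
        then show ?thesis using True by (simp add: \<psi>_def)
      qed (simp add: \<psi>_def)
    qed
    show "continuous_on (simplex_bd D) \<zeta>"
    proof (rule continuous_on_coordinatewise_then_product)
      fix i
      show "continuous_on (simplex_bd D) (\<lambda>y. \<zeta> y i)"
      proof (cases "i \<le> m")
        case True
        have "continuous_on (simplex_bd D) (\<lambda>y. (y (e i) - y (e (Suc m))) / N y)"
          unfolding N_def
          by (intro continuous_intros) (use N_pos in \<open>force simp: N_def\<close>)
        then show ?thesis using True by (simp add: \<zeta>_def)
      qed (simp add: \<zeta>_def)
    qed
  qed (use \<psi>_bd \<zeta>_sphere inv in auto)
qed

text \<open>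
  The simplicial map \<open>\<phi>\<close> pushes the extension of \<open>g\<close> back into the boundary sphere, where the carrier
  condition makes \<open>\<phi> \<circ> g\<close> homotopic to the identity along segments.
\<close>

lemma not_space_k_connectedI:
  fixes \<phi> :: "'a \<Rightarrow> 'a"
  assumes V: "finite V" and KV: "K \<subseteq> Pow V" and D: "finite D" "card D = m + 2"
    and \<phi>: "\<phi> ` V \<subseteq> D" "\<And>\<sigma>. \<sigma> \<in> K \<Longrightarrow> \<phi> ` \<sigma> \<noteq> D"
    and g: "continuous_on (simplex_bd D) g" "g \<in> simplex_bd D \<rightarrow> realization K"
    and carrier: "\<And>x v. x \<in> simplex_bd D \<Longrightarrow> g x v \<noteq> 0 \<Longrightarrow> x (\<phi> v) \<noteq> 0"
    and mk: "int m \<le> k"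
  shows "\<not> space_k_connected k (geometric_realization K)"
proof
  assume conn: "space_k_connected k (geometric_realization K)"
  obtain \<psi> :: "(nat \<Rightarrow> real) \<Rightarrow> 'a \<Rightarrow> real" and \<zeta> :: "('a \<Rightarrow> real) \<Rightarrow> nat \<Rightarrow> real"
    where \<psi>: "continuous_on (unit_sphere m) \<psi>" "\<psi> \<in> unit_sphere m \<rightarrow> simplex_bd D"
    and \<zeta>: "continuous_on (simplex_bd D) \<zeta>" "\<zeta> \<in> simplex_bd D \<rightarrow> unit_sphere m"
    and inv: "\<And>u. u \<in> unit_sphere m \<Longrightarrow> \<zeta> (\<psi> u) = u"
    using simplex_bd_sphere[OF D] by metis
  \<comment> \<open>The affine extension of \<open>\<phi>\<close> in barycentric coordinates: the
    weights over each fibre are added up.\<close>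
  define push where "push x = (\<lambda>d. if d \<in> D then \<Sum>v\<in>{v\<in>V. \<phi> v = d}. x v else 0)" for x :: "'a \<Rightarrow> real"
  have push_bd: "push x \<in> simplex_bd D" if x: "x \<in> realization K" for x
  proof -
    have supp: "{v. x v \<noteq> 0} \<in> K" "\<And>v. 0 \<le> x v" using x unfolding realization_def by auto
    then have "{v. x v \<noteq> 0} \<subseteq> V" using KV by blast
    then have "sum x V = 1" using realization_sum x V by blast
    moreover have "sum (push x) D = sum x V"
      using sum.group[OF V D(1) \<phi>(1), of x] by (simp add: push_def)
    moreover have "\<phi> ` {v. x v \<noteq> 0} \<subseteq> D" using \<phi>(1) \<open>{v. x v \<noteq> 0} \<subseteq> V\<close> by blast
    then obtain d where "d \<in> D" "d \<notin> \<phi> ` {v. x v \<noteq> 0}" using \<phi>(2)[OF supp(1)] by blast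
    then have "\<exists>d\<in>D. push x d = 0" by (intro bexI[of _ d]) (auto simp: push_def intro!: sum.neutral)
    moreover have "0 \<le> push x d" for d
      by (auto simp: push_def supp(2) intro: sum_nonneg)
    ultimately show ?thesis
      unfolding simplex_bd_def full_simplex_def by (simp add: push_def)
  qed
  have push_cont: "continuous_on S push" for S
  proof (rule continuous_on_coordinatewise_then_product)
    fix d show "continuous_on S (\<lambda>x. push x d)"
      unfolding push_def by (cases "d \<in> D") (auto intro!: continuous_intros)
  qed
  define Ball where "Ball = {x. (\<Sum>i\<le>m. x i ^ 2) \<le> 1 \<and> (\<forall>i>m. x i = (0::real))}"
  have "continuous_map (nsphere m) (geometric_realization K) (g \<circ> \<psi>)"
    unfolding nsphere_eq geometric_realization_eq continuous_map_subtopology_eu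
  proof
    show "continuous_on (unit_sphere m) (g \<circ> \<psi>)"
      unfolding comp_def by (rule continuous_on_compose2[OF g(1) \<psi>(1)]) (use \<psi>(2) in auto)
    show "g \<circ> \<psi> \<in> unit_sphere m \<rightarrow> realization K" using \<psi>(2) g(2) by auto
  qed
  then obtain G where G: "continuous_map (nball (Suc m)) (geometric_realization K) G"
      "\<forall>x\<in>topspace (nsphere m). G x = (g \<circ> \<psi>) x"
    using conn mk unfolding space_k_connected_def by blast
  have G_cont: "continuous_on Ball G" and G_im: "G \<in> Ball \<rightarrow> realization K"
    using G(1) unfolding nball_eq geometric_realization_eq continuous_map_subtopology_eu Ball_def by auto
  have G_eq: "G u = g (\<psi> u)" if "u \<in> unit_sphere m" for u
    using G(2) that unfolding nsphere_eq by simp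
  define h where "h x = push (G x)" for x
  have h_cont: "continuous_on Ball h" and h_im: "h \<in> Ball \<rightarrow> simplex_bd D"
    unfolding h_def using push_bd G_im
    by (auto intro!: continuous_on_compose2[OF push_cont G_cont])
  have sphere_ball: "unit_sphere m \<subseteq> Ball" unfolding unit_sphere_def Ball_def by auto
  \<comment> \<open>A coordinate \<open>d\<close> that vanishes at \<open>\<psi> u\<close> also
    vanishes at \<open>h u\<close>, by the carrier condition. Both points thus lie in a common
    facet, and the segment never enters the interior of the simplex.\<close>
  have seg: "(\<lambda>v. (1 - t) * \<psi> u v + t * h u v) \<in> simplex_bd D"
    if t: "0 \<le> t" "t \<le> 1" and u: "u \<in> unit_sphere m" for t u
  proof -
    have y: "\<psi> u \<in> simplex_bd D" "h u \<in> simplex_bd D" using \<psi>(2) h_im u sphere_ball by auto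
    obtain d where d: "d \<in> D" "\<psi> u d = 0" using y(1) unfolding simplex_bd_def by blast
    have "h u d = 0"
      unfolding h_def push_def G_eq[OF u] using carrier[OF y(1)] d by (auto intro!: sum.neutral)
    then have "\<exists>d\<in>D. (1 - t) * \<psi> u d + t * h u d = 0"
      using d by (intro bexI[of _ d]) auto
    then show ?thesis
      using y t unfolding simplex_bd_def full_simplex_def
      by (auto simp: sum.distrib sum_distrib_left[symmetric])
  qed
  have "homotopic_with_canon (\<lambda>x. True) (unit_sphere m) (unit_sphere m) (\<lambda>u. \<zeta> (\<psi> u)) (\<lambda>u. \<zeta> (h u))"
    unfolding homotopic_with_def prod_topology_subtopology_eu
  proof (intro exI[of _ "\<lambda>(t, u). \<zeta> (\<lambda>v. (1 - t) * \<psi> u v + t * h u v)"] conjI)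
    have "continuous_on ({0..1} \<times> unit_sphere m) (\<lambda>p v. (1 - fst p) * \<psi> (snd p) v + fst p * h (snd p) v)"
      by (intro continuous_on_coordinatewise_then_product continuous_intros
          continuous_on_product_then_coordinatewise[OF continuous_on_compose2[OF \<psi>(1)]]
          continuous_on_product_then_coordinatewise[OF continuous_on_compose2[OF h_cont]])
        (use sphere_ball in auto)
    then have "continuous_on ({0..1} \<times> unit_sphere m) (\<lambda>p. \<zeta> (\<lambda>v. (1 - fst p) * \<psi> (snd p) v + fst p * h (snd p) v))"
      by (rule continuous_on_compose2[OF \<zeta>(1)]) (use seg in auto)
    then show "continuous_map (top_of_set ({0..1} \<times> unit_sphere m)) (top_of_set (unit_sphere m))
        (\<lambda>(t, u). \<zeta> (\<lambda>v. (1 - t) * \<psi> u v + t * h u v))"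
      using \<zeta>(2) seg by (auto simp: case_prod_unfold Pi_iff)
  qed auto
  then have "homotopic_with_canon (\<lambda>x. True) (unit_sphere m) (unit_sphere m) id (\<lambda>u. \<zeta> (h u))"
    by (rule homotopic_with_eq) (use inv in auto)
  \<comment> \<open>Shrinking the radius inside the ball contracts the other map to its value at the
    centre. Together the two homotopies deform the identity of the sphere to a constant.\<close>
  moreover have "homotopic_with_canon (\<lambda>x. True) (unit_sphere m) (unit_sphere m) (\<lambda>u. \<zeta> (h u)) (\<lambda>u. \<zeta> (h (\<lambda>i. 0)))"
    unfolding homotopic_with_def prod_topology_subtopology_eu
  proof (intro exI[of _ "\<lambda>(t, u). \<zeta> (h (\<lambda>i. (1 - t) * u i))"] conjI)
    have in_ball: "(\<lambda>i. (1 - t) * u i) \<in> Ball" if "0 \<le> t" "t \<le> 1" "u \<in> unit_sphere m" for t u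
    proof -
      have "(\<Sum>i\<le>m. ((1 - t) * u i) ^ 2) = (1 - t) ^ 2"
        using that(3) unfolding unit_sphere_def by (simp add: power_mult_distrib sum_distrib_left[symmetric])
      moreover have "(1 - t) ^ 2 \<le> 1" using that by (simp add: power_le_one)
      ultimately show ?thesis using that(3) unfolding unit_sphere_def Ball_def by simp
    qed
    have "continuous_on ({0..1} \<times> unit_sphere m) (\<lambda>p i. (1 - fst p) * snd p i)"
      by (intro continuous_on_coordinatewise_then_product continuous_intros
          continuous_on_product_then_coordinatewise[OF continuous_on_snd])
    then have "continuous_on ({0..1} \<times> unit_sphere m) (\<lambda>p. h (\<lambda>i. (1 - fst p) * snd p i))"
      by (rule continuous_on_compose2[OF h_cont]) (use in_ball in auto)
    then have "continuous_on ({0..1} \<times> unit_sphere m) (\<lambda>p. \<zeta> (h (\<lambda>i. (1 - fst p) * snd p i)))"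
      by (rule continuous_on_compose2[OF \<zeta>(1)]) (use in_ball h_im in auto)
    then show "continuous_map (top_of_set ({0..1} \<times> unit_sphere m)) (top_of_set (unit_sphere m))
        (\<lambda>(t, u). \<zeta> (h (\<lambda>i. (1 - t) * u i)))"
      using \<zeta>(2) h_im in_ball by (auto simp: case_prod_unfold Pi_iff)
  qed auto
  ultimately have "contractible_space (nsphere m)"
    unfolding nsphere_eq contractible_space_def by (blast intro: homotopic_with_trans)
  then show False using non_contractible_space_nsphere by blast
qed

section \<open>Extending the inclusion of the boundary of a simplex\<close>

text \<open>The boundary sphere of the simplex on \<open>K\<close> is null-homotopic in the
  realization of \<open>L\<close>, expressed as an extension so that fillings can be glued.
  \<open>K\<close> itself need not belong to \<open>L\<close>.\<close>

definition fillable :: "'a set set \<Rightarrow> 'a set \<Rightarrow> bool" where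
  "fillable L K \<longleftrightarrow> (\<exists>e. continuous_on (full_simplex K) e \<and> e \<in> full_simplex K \<rightarrow> realization L \<and>
     (\<forall>x\<in>simplex_bd K. e x = x))"

lemma fillable_face:
  assumes "finite K" "\<And>\<sigma>. \<sigma> \<subseteq> K \<Longrightarrow> \<sigma> \<in> L"
  shows "fillable L K"
  unfolding fillable_def
proof (intro exI[of _ id] conjI)
  show "id \<in> full_simplex K \<rightarrow> realization L"
  proof
    fix x assume x: "x \<in> full_simplex K"
    then have "{v. x v \<noteq> 0} \<subseteq> K" unfolding full_simplex_def by auto
    then show "id x \<in> realization L" using realizationI[OF x assms(1)] assms(2) by simp
  qed
qed (auto simp: continuous_on_id)

text \<open>
  Subdivide the simplex on \<open>T + u\<close> at its barycentre and send the new vertex to \<open>u'\<close>: the facets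
  through \<open>u\<close> go to simplices of \<open>L\<close>, and the facet opposite \<open>u\<close> becomes the simplex on \<open>T + u'\<close>.
\<close>

lemma fillable_exchange:
  assumes T: "finite T" "u \<notin> T" "u' \<notin> T" "u \<noteq> u'"
    and L: "\<And>t \<sigma>. t \<in> T \<Longrightarrow> \<sigma> \<subseteq> insert u (insert u' (T - {t})) \<Longrightarrow> \<sigma> \<in> L"
    and fill: "fillable L (insert u' T)"
  shows "fillable L (insert u T)"
proof -
  define K where "K = insert u T"
  obtain e where e: "continuous_on (full_simplex (insert u' T)) e"
      "e \<in> full_simplex (insert u' T) \<rightarrow> realization L" "\<And>x. x \<in> simplex_bd (insert u' T) \<Longrightarrow> e x = x"
    using fill unfolding fillable_def by blast
  have K: "finite K" "K \<noteq> {}" "u \<in> K" "u' \<notin> K" "T \<subseteq> K" using T by (auto simp: K_def)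
  \<comment> \<open>A point of the simplex is a combination of the vertices with weights
    \<open>x v - lam x\<close> and of the barycentre with weight \<open>card K * lam x\<close>.
    Hence \<open>y\<close> is the simplicial map of the subdivision that sends the barycentre to
    \<open>u'\<close>.\<close>
  define lam where "lam x = Min (x ` K)" for x :: "'a \<Rightarrow> real"
  define y where "y x = (\<lambda>v. if v \<in> K then x v - lam x else if v = u' then real (card K) * lam x else 0)" for x
  have lam_le: "lam x \<le> x v" if "v \<in> K" for x v
    unfolding lam_def using that K by (intro Min_le) auto
  have lam_ex: "\<exists>v\<in>K. x v = lam x" for x
  proof -
    have "lam x \<in> x ` K" unfolding lam_def using K by (intro Min_in) auto
    then show ?thesis by auto
  qed
  have lam_cont: "continuous_on S lam" for S
    unfolding lam_def by (intro continuous_on_Min_image continuous_on_coordinate K)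
  have y_cont: "continuous_on S y" for S
  proof (rule continuous_on_coordinatewise_then_product)
    fix v show "continuous_on S (\<lambda>x. y x v)"
      unfolding y_def by (cases "v \<in> K"; cases "v = u'") (auto intro!: continuous_intros lam_cont)
  qed
  have lam_nonneg: "0 \<le> lam x" if "x \<in> full_simplex K" for x
  proof -
    obtain v where "x v = lam x" using lam_ex by blast
    moreover have "0 \<le> x v" using that unfolding full_simplex_def by blast
    ultimately show ?thesis by simp
  qed
  have y_simplex: "y x \<in> full_simplex (insert u' K)" if x: "x \<in> full_simplex K" for x
  proof -
    have "sum (y x) (insert u' K) = y x u' + sum (y x) K" using K by simp
    also have "sum (y x) K = (\<Sum>v\<in>K. x v - lam x)" by (intro sum.cong) (auto simp: y_def)
    also have "\<dots> = 1 - real (card K) * lam x"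
      using x by (simp add: sum_subtractf full_simplex_def)
    finally have "sum (y x) (insert u' K) = 1" using K by (simp add: y_def)
    then show ?thesis
      using lam_le lam_nonneg[OF x] unfolding full_simplex_def by (auto simp: y_def)
  qed
  \<comment> \<open>\<open>S1\<close> is the cone from the barycentre over the facet opposite
    \<open>u\<close>, and \<open>S2\<close> consists of the cones over the other facets.
    \<open>y\<close> carries their intersection into the boundary of the simplex on
    \<open>T + u'\<close>, where \<open>e\<close> is the identity, so the two definitions agree
    there.\<close>
  define S1 where "S1 = {x \<in> full_simplex K. x u = lam x}"
  define S2 where "S2 = (\<Union>t\<in>T. {x \<in> full_simplex K. x t = lam x})"
  have S12: "S1 \<union> S2 = full_simplex K"
    using lam_ex unfolding S1_def S2_def K_def by blast
  have closed: "closedin (top_of_set (full_simplex K)) {x \<in> full_simplex K. x v = lam x}" for v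
  proof -
    have "closedin (top_of_set (full_simplex K)) {x \<in> full_simplex K. x v - lam x = 0}"
      by (intro continuous_closedin_preimage_constant continuous_intros lam_cont)
    then show ?thesis by simp
  qed
  have y_S1: "y x \<in> full_simplex (insert u' T)" if "x \<in> S1" for x
  proof -
    have x: "x \<in> full_simplex K" "y x u = 0" using that K by (auto simp: S1_def y_def)
    have "sum (y x) (insert u' K) = sum (y x) (insert u' T)"
      using x(2) T unfolding K_def by (intro sum.mono_neutral_right) auto
    then show ?thesis using y_simplex[OF x(1)] x(2) unfolding full_simplex_def K_def by auto
  qed
  have y_S2: "y x \<in> realization L" if x: "x \<in> S2" for x
  proof -
    obtain t where t: "t \<in> T" "x \<in> full_simplex K" "x t = lam x" using x unfolding S2_def by blast
    then have "y x t = 0" using K by (auto simp: y_def)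
    then have "{v. y x v \<noteq> 0} \<subseteq> insert u (insert u' (T - {t}))"
      using y_simplex[OF t(2)] unfolding full_simplex_def K_def by auto
    then show ?thesis using realizationI[OF y_simplex[OF t(2)]] L t(1) K(1) by simp
  qed
  have agree: "e (y x) = y x" if x: "x \<in> S1" "x \<in> S2" for x
  proof -
    obtain t where "t \<in> T" "x t = lam x" using x(2) unfolding S2_def by blast
    then have "y x t = 0" using K by (auto simp: y_def)
    then show ?thesis using e(3) y_S1[OF x(1)] \<open>t \<in> T\<close> unfolding simplex_bd_def by blast
  qed
  define E where "E x = (if x u = lam x then e (y x) else y x)" for x
  have "continuous_on (S1 \<union> S2) E"
    unfolding E_def
  proof (rule continuous_on_cases_local)
    show "closedin (top_of_set (S1 \<union> S2)) S1" unfolding S12 unfolding S1_def by (rule closed)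
    show "closedin (top_of_set (S1 \<union> S2)) S2" unfolding S12 unfolding S2_def
      by (intro closedin_Union) (use T(1) closed in auto)
    show "continuous_on S1 (\<lambda>x. e (y x))"
      by (rule continuous_on_compose2[OF e(1) y_cont]) (use y_S1 in auto)
    show "e (y x) = y x" if "x \<in> S1 \<and> x u \<noteq> lam x \<or> x \<in> S2 \<and> x u = lam x" for x
    proof -
      have "x \<in> S1 \<and> x \<in> S2" using that unfolding S1_def S2_def by blast
      then show ?thesis using agree by blast
    qed
  qed (rule y_cont)
  then have "continuous_on (full_simplex K) E" unfolding S12 .
  moreover have "E x \<in> realization L" if "x \<in> full_simplex K" for x
  proof (cases "x u = lam x")
    case True
    then have "x \<in> S1" using that by (simp add: S1_def)
    then show ?thesis using e(2) y_S1 True by (auto simp: E_def)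
  next
    case False
    then have "x \<in> S2" using S12 that by (auto simp: S1_def)
    then show ?thesis using y_S2 False by (auto simp: E_def)
  qed
  \<comment> \<open>On the boundary the barycentre has weight 0, so the subdivision map is the
    identity there.\<close>
  moreover have "E x = x" if x: "x \<in> simplex_bd K" for x
  proof -
    have xs: "x \<in> full_simplex K" using x unfolding simplex_bd_def by blast
    obtain d where "d \<in> K" "x d = 0" using x unfolding simplex_bd_def by blast
    then have lam0: "lam x = 0" using lam_le[of d x] lam_nonneg[OF xs] by simp
    have yx: "y x = x"
    proof
      fix v show "y x v = x v" using xs lam0 unfolding y_def full_simplex_def by auto
    qed
    show ?thesis
    proof (cases "x u = lam x")
      case True
      then have "x \<in> full_simplex (insert u' T)" using y_S1[of x] xs yx by (simp add: S1_def)
      moreover have "x u' = 0" using xs K unfolding full_simplex_def by simp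
      ultimately have "x \<in> simplex_bd (insert u' T)" unfolding simplex_bd_def by blast
      then show ?thesis using e(3) yx by (simp add: E_def)
    qed (simp add: E_def yx)
  qed
  ultimately show ?thesis unfolding fillable_def K_def by blast
qed

text \<open>The boundary of the simplex on \<open>S + a + b\<close> consists of the face without
  \<open>b\<close>, the face without \<open>a\<close>, and the faces missing some vertex of
  \<open>S\<close>. The two fillings are used on the first two and the identity on the third.
  \<open>LA\<close> and \<open>LB\<close> record where the fillings live, which the carrier
  condition will require.\<close>

lemma fillable_join:
  assumes S: "finite S" "a \<notin> S" "b \<notin> S" "a \<noteq> b"
    and A: "fillable LA (insert a S)" "LA \<subseteq> L" and B: "fillable LB (insert b S)" "LB \<subseteq> L"
    and L: "\<And>s \<sigma>. s \<in> S \<Longrightarrow> \<sigma> \<subseteq> insert a (insert b (S - {s})) \<Longrightarrow> \<sigma> \<in> L"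
  obtains g where "continuous_on (simplex_bd (insert a (insert b S))) g"
    "g \<in> simplex_bd (insert a (insert b S)) \<rightarrow> realization L"
    "\<And>x. x \<in> simplex_bd (insert a (insert b S)) \<Longrightarrow> x b = 0 \<Longrightarrow> g x \<in> realization LA"
    "\<And>x. x \<in> simplex_bd (insert a (insert b S)) \<Longrightarrow> x a = 0 \<Longrightarrow> x b \<noteq> 0 \<Longrightarrow> g x \<in> realization LB"
    "\<And>x. x \<in> simplex_bd (insert a (insert b S)) \<Longrightarrow> (\<exists>s\<in>S. x s = 0) \<or> x a = 0 \<and> x b = 0 \<Longrightarrow> g x = x"
proof -
  define D where "D = insert a (insert b S)"
  obtain eA where eA: "continuous_on (full_simplex (insert a S)) eA"
      "eA \<in> full_simplex (insert a S) \<rightarrow> realization LA" "\<And>x. x \<in> simplex_bd (insert a S) \<Longrightarrow> eA x = x"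
    using A(1) unfolding fillable_def by blast
  obtain eB where eB: "continuous_on (full_simplex (insert b S)) eB"
      "eB \<in> full_simplex (insert b S) \<rightarrow> realization LB" "\<And>x. x \<in> simplex_bd (insert b S) \<Longrightarrow> eB x = x"
    using B(1) unfolding fillable_def by blast
  define C1 where "C1 = {x \<in> simplex_bd D. x b = 0}"
  define C2 where "C2 = {x \<in> simplex_bd D. x a = 0}"
  define C3 where "C3 = (\<Union>s\<in>S. {x \<in> simplex_bd D. x s = 0})"
  have cover: "C1 \<union> (C2 \<union> C3) = simplex_bd D"
    unfolding C1_def C2_def C3_def unfolding simplex_bd_def D_def by blast
  have sA: "x \<in> full_simplex (insert a S)" if "x \<in> C1" for x
    using that S unfolding C1_def simplex_bd_def full_simplex_def D_def by auto
  have sB: "x \<in> full_simplex (insert b S)" if "x \<in> C2" for x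
    using that S unfolding C2_def simplex_bd_def full_simplex_def D_def by auto
  have agreeA: "eA x = x" if "x \<in> C1" "x \<in> C2 \<union> C3" for x
  proof -
    have "\<exists>d\<in>insert a S. x d = 0" using that unfolding C2_def C3_def by auto
    then show ?thesis using eA(3) sA[OF that(1)] unfolding simplex_bd_def by blast
  qed
  have agreeB: "eB x = x" if "x \<in> C2" "x \<in> C1 \<union> C3" for x
  proof -
    have "\<exists>d\<in>insert b S. x d = 0" using that unfolding C1_def C3_def by auto
    then show ?thesis using eB(3) sB[OF that(1)] unfolding simplex_bd_def by blast
  qed
  have closed: "closedin (top_of_set U) {x \<in> U. x v = (0::real)}" for U and v :: 'a
    by (intro continuous_closedin_preimage_constant continuous_intros)
  have closed_Un: "closedin (top_of_set U) (\<Union>s\<in>S. {x \<in> U. x s = (0::real)})" for U :: "('a \<Rightarrow> real) set"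
    by (intro closedin_Union) (use S(1) closed in auto)
  define gB where "gB x = (if x a = 0 then eB x else x)" for x
  define g where "g x = (if x b = 0 then eA x else gB x)" for x
  have "continuous_on (C2 \<union> C3) gB"
    unfolding gB_def
  proof (rule continuous_on_cases_local)
    have "C2 = {x \<in> C2 \<union> C3. x a = 0}" unfolding C2_def C3_def by blast
    then show "closedin (top_of_set (C2 \<union> C3)) C2" using closed[of "C2 \<union> C3" a] by simp
    have "C3 = (\<Union>s\<in>S. {x \<in> C2 \<union> C3. x s = 0})" unfolding C2_def C3_def by blast
    then show "closedin (top_of_set (C2 \<union> C3)) C3" using closed_Un[of "C2 \<union> C3"] by simp
    show "continuous_on C2 eB" by (rule continuous_on_subset[OF eB(1)]) (use sB in blast)
    show "eB x = x" if "x \<in> C2 \<and> x a \<noteq> 0 \<or> x \<in> C3 \<and> x a = 0" for x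
    proof -
      have "x \<in> C2 \<and> x \<in> C3" using that unfolding C2_def C3_def by blast
      then show ?thesis using agreeB by blast
    qed
  qed (rule continuous_on_id)
  have "continuous_on (C1 \<union> (C2 \<union> C3)) g"
    unfolding g_def
  proof (rule continuous_on_cases_local)
    show "closedin (top_of_set (C1 \<union> (C2 \<union> C3))) C1" unfolding cover unfolding C1_def by (rule closed)
    show "closedin (top_of_set (C1 \<union> (C2 \<union> C3))) (C2 \<union> C3)" unfolding cover unfolding C2_def C3_def
      by (intro closedin_Un closed closed_Un)
    show "continuous_on C1 eA" by (rule continuous_on_subset[OF eA(1)]) (use sA in blast)
    show "continuous_on (C2 \<union> C3) gB" by fact
    show "eA x = gB x" if "x \<in> C1 \<and> x b \<noteq> 0 \<or> x \<in> C2 \<union> C3 \<and> x b = 0" for x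
    proof -
      have x: "x \<in> C1" "x \<in> C2 \<union> C3" using that unfolding C1_def C2_def C3_def by auto
      then have "gB x = x" using agreeB[of x] unfolding gB_def C2_def C3_def by auto
      then show ?thesis using agreeA[OF x] by simp
    qed
  qed
  then have cont: "continuous_on (simplex_bd D) g" unfolding cover .
  have gA: "g x \<in> realization LA" if "x \<in> simplex_bd D" "x b = 0" for x
    using that eA(2) sA[of x] unfolding g_def C1_def by auto
  have gB: "g x \<in> realization LB" if "x \<in> simplex_bd D" "x a = 0" "x b \<noteq> 0" for x
    using that eB(2) sB[of x] unfolding g_def gB_def C2_def by auto
  have gid: "g x = x" if "x \<in> simplex_bd D" "(\<exists>s\<in>S. x s = 0) \<or> x a = 0 \<and> x b = 0" for x
    using that agreeA[of x] agreeB[of x] unfolding g_def gB_def C1_def C2_def C3_def by auto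
  have "g x \<in> realization L" if x: "x \<in> simplex_bd D" for x
  proof (cases "x b = 0")
    case True then show ?thesis using gA[OF x] realization_mono[OF A(2)] by blast
  next
    case False
    show ?thesis
    proof (cases "x a = 0")
      case True then show ?thesis using gB[OF x] False realization_mono[OF B(2)] by blast
    next
      case a: False
      obtain s where s: "s \<in> S" "x s = 0" using x False a unfolding simplex_bd_def D_def by blast
      have xs: "x \<in> full_simplex D" using x unfolding simplex_bd_def by blast
      then have "{v. x v \<noteq> 0} \<subseteq> insert a (insert b (S - {s}))"
        using s unfolding full_simplex_def D_def by auto
      then have "x \<in> realization L" using realizationI[OF xs] L s(1) S(1) by (simp add: D_def)
      then show ?thesis using gid[OF x] s by metis
    qed
  qed
  then show ?thesis using that[of g] cont gA gB gid unfolding D_def by blast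
qed

section \<open>The neighbourhood complex of a stiff chordal graph\<close>

abbreviation adj :: "('a, 'b) pre_digraph \<Rightarrow> 'a \<Rightarrow> 'a \<Rightarrow> bool" where
  "adj G \<equiv> \<lambda>u v. u \<rightarrow>\<^bsub>G\<^esub> v"

lemma sgraph_adj: "graph G \<Longrightarrow> sgraph (adj G)"
proof
  fix u v
  assume G: "graph G"
  then interpret graph G .
  show "u \<rightarrow>\<^bsub>G\<^esub> v \<Longrightarrow> v \<rightarrow>\<^bsub>G\<^esub> u"
    using sym_arcs unfolding symmetric_def by (auto dest: symD)
  show "\<not> u \<rightarrow>\<^bsub>G\<^esub> u" by (auto dest: adj_not_same)
qed

text \<open>The cyclic list of a hole is the vertex part of an isomorphism from a cycle graph onto
  the subgraph induced by the vertices of the hole.\<close>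

lemma no_hole_if_chordal:
  assumes "graph G" "chordal G"
  shows "sgraph.no_hole (adj G) (verts G)"
proof -
  interpret graph G by fact
  interpret sg: sgraph "adj G" by (rule sgraph_adj) fact
  show ?thesis
    unfolding sg.no_hole_def
  proof
    assume "\<exists>k\<ge>4. \<exists>c::nat \<Rightarrow> 'a. inj_on c {..<k} \<and> c ` {..<k} \<subseteq> verts G \<and>
      (\<forall>i<k. \<forall>j<k. c i \<rightarrow>\<^bsub>G\<^esub> c j \<longleftrightarrow> j = (i + 1) mod k \<or> i = (j + 1) mod k)"
    then obtain k and c :: "nat \<Rightarrow> 'a" where k: "4 \<le> k" and c: "inj_on c {..<k}" "c ` {..<k} \<subseteq> verts G"
      and adj: "\<And>i j. i < k \<Longrightarrow> j < k \<Longrightarrow> c i \<rightarrow>\<^bsub>G\<^esub> c j \<longleftrightarrow> j = (i + 1) mod k \<or> i = (j + 1) mod k"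
      by blast
    \<comment> \<open>Arcs of \<open>G\<close> are abstract objects, so the arc over a pair is
      chosen; the absence of parallel arcs makes it the only one.\<close>
    define arc where "arc = (\<lambda>(i, j). SOME a. a \<in> arcs G \<and> tail G a = c i \<and> head G a = c j)"
    define hom :: "(nat, nat \<times> nat, 'a, 'b) digraph_isomorphism" where
      "hom = \<lparr>iso_verts = c, iso_arcs = arc, iso_head = head G, iso_tail = tail G\<rparr>"
    define C where "C = with_proj (cycle_graph k)"
    have C: "verts C = {..<k}" "tail C = fst" "head C = snd"
        "arcs C = {(i, j). i < k \<and> j < k \<and> (j = (i + 1) mod k \<or> i = (j + 1) mod k)}"
      unfolding C_def cycle_graph_def by auto
    have arc: "arc (i, j) \<in> arcs G \<and> tail G (arc (i, j)) = c i \<and> head G (arc (i, j)) = c j"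
      if "(i, j) \<in> arcs C" for i j
    proof -
      have "c i \<rightarrow>\<^bsub>G\<^esub> c j" using that adj unfolding C by auto
      then have "\<exists>a. a \<in> arcs G \<and> tail G a = c i \<and> head G a = c j" unfolding arcs_ends_conv by auto
      then show ?thesis unfolding arc_def by simp (rule someI_ex)
    qed
    define H where "H = G \<restriction> (c ` {..<k})"
    have "induced_subgraph H G" unfolding H_def using c(2) by (rule induced_induce)
    moreover have "digraph_iso C H"
      unfolding digraph_iso_def
    proof (intro exI[of _ hom] conjI)
      have "wf_digraph C" by unfold_locales (auto simp: C)
      moreover have "inj_on arc (arcs C)"
      proof (rule inj_onI)
        fix p q assume pq: "p \<in> arcs C" "q \<in> arcs C" "arc p = arc q"
        obtain i j i' j' where ij: "p = (i, j)" "q = (i', j')" by fastforce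
        then have "c i = c i'" "c j = c j'" using arc[of i j] arc[of i' j'] pq by auto
        moreover have "{i, j, i', j'} \<subseteq> {..<k}" using pq ij unfolding C by auto
        ultimately show "p = q" using inj_onD[OF c(1)] ij by auto
      qed
      ultimately show "pre_digraph.digraph_isomorphism C hom"
        using c(1) arc unfolding pre_digraph.digraph_isomorphism_def hom_def by (auto simp: C)
      have "arcs H = arc ` arcs C"
      proof (intro equalityI subsetI)
        fix a assume "a \<in> arcs H"
        then obtain i j where ij: "i < k" "j < k" "a \<in> arcs G" "tail G a = c i" "head G a = c j"
          unfolding H_def by auto
        then have "c i \<rightarrow>\<^bsub>G\<^esub> c j" unfolding arcs_ends_conv by force
        then have "(i, j) \<in> arcs C" using adj ij unfolding C by auto
        moreover have "arc (i, j) = a"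
          using arc[OF calculation] ij by (intro no_multi_arcs) (auto simp: arc_to_ends_def)
        ultimately show "a \<in> arc ` arcs C" by force
      next
        fix a assume "a \<in> arc ` arcs C"
        then obtain i j where ij: "(i, j) \<in> arcs C" "a = arc (i, j)" by force
        then show "a \<in> arcs H" using arc[OF ij(1)] unfolding H_def C by auto
      qed
      then show "H = app_iso hom C"
        unfolding app_iso_def hom_def C H_def by (simp add: induce_subgraph_def C)
    qed
    ultimately show False using assms(2) k unfolding chordal_def C_def by blast
  qed
qed

lemma successively_vwalk_arcs:
  "set (vwalk_arcs p) \<subseteq> arcs_ends G \<longleftrightarrow> successively (adj G) p"
  by (induction p rule: vwalk_arcs.induct) auto

lemma vpath_iff_path:
  assumes "sgraph (adj G)"
  shows "vpath p G \<and> hd p = x \<and> last p = y \<longleftrightarrow> sgraph.path (adj G) (verts G) p x y"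
  unfolding vpath_def vwalk_def successively_vwalk_arcs sgraph.path_def[OF assms] by blast

lemma successively_crosses_separator:
  assumes "successively R p" "p \<noteq> []" "hd p \<in> A" "last p \<in> B" "set p \<subseteq> A \<union> S \<union> B"
    "\<forall>a\<in>A. \<forall>b\<in>B. \<not> R a b" "A \<inter> B = {}"
  shows "set p \<inter> S \<noteq> {}"
  using assms
proof (induction p)
  case (Cons x p)
  show ?case
  proof (cases "p = []")
    case True
    then show ?thesis using Cons.prems by auto
  next
    case False
    have succ: "R x (hd p)" "successively R p" using Cons.prems(1) False by (cases p; auto)+
    have "hd p \<in> A \<union> S \<union> B" using Cons.prems(5) False by (auto dest: hd_in_set)
    then consider "hd p \<in> S" | "hd p \<in> A" using Cons.prems(3,6) succ(1) by auto
    then show ?thesis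
    proof cases
      case 1 then show ?thesis using False by (auto dest: hd_in_set)
    next
      case 2
      then show ?thesis using Cons succ(2) False by auto
    qed
  qed
qed simp

text \<open>The easy direction of Menger's theorem: each path from \<open>A\<close> to
  \<open>B\<close> meets \<open>S\<close>, and different paths share only their ends, which lie
  outside \<open>S\<close>.\<close>

lemma card_separator_ge:
  assumes G: "graph G" and conn: "graph_k_connected k G"
    and sep: "sgraph.separation (adj G) (verts G) A S B"
  shows "k \<le> card S"
proof -
  interpret graph G by fact
  interpret sg: sgraph "adj G" by (rule sgraph_adj) fact
  have sp: "verts G = A \<union> S \<union> B" "A \<inter> S = {}" "B \<inter> S = {}" "A \<inter> B = {}" "\<forall>a\<in>A. \<forall>b\<in>B. \<not> adj G a b"
    and ne: "A \<noteq> {}" "B \<noteq> {}"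
    using sep unfolding sg.separation_def by auto
  obtain a b where ab: "a \<in> A" "b \<in> B" using ne by blast
  then have "a \<in> verts G" "b \<in> verts G" "a \<noteq> b" using sp by auto
  then obtain P where P: "finite P" "k \<le> card P" "internally_disjoint_paths G a b P"
    using conn unfolding graph_k_connected_def by blast
  have finS: "finite S" using sp(1) by (metis finite_Un finite_verts)
  have hits: "set p \<inter> S \<noteq> {}" if "p \<in> P" for p
  proof -
    have "vpath p G" "hd p = a" "last p = b"
      using P(3) that unfolding internally_disjoint_paths_def by auto
    then show ?thesis
      using successively_crosses_separator[of "adj G" p A B S] ab sp
      unfolding vpath_def vwalk_def successively_vwalk_arcs by auto
  qed
  define f where "f p = (SOME s. s \<in> set p \<inter> S)" for p
  have f: "f p \<in> set p \<inter> S" if "p \<in> P" for p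
    unfolding f_def using hits[OF that] some_in_eq[of "set p \<inter> S"] by blast
  have "inj_on f P"
  proof (rule inj_onI, rule ccontr)
    fix p q assume pq: "p \<in> P" "q \<in> P" "f p = f q" "p \<noteq> q"
    then have "set p \<inter> set q = {a, b}" using P(3) unfolding internally_disjoint_paths_def by blast
    moreover have "f p \<in> set p \<inter> set q" using f[OF pq(1)] f[OF pq(2)] pq(3) by simp
    ultimately have "f p = a \<or> f p = b" by blast
    then show False using f[OF pq(1)] ab sp(2,3) by auto
  qed
  then have "card P \<le> card S" using f finS by (intro card_inj_on_le) auto
  then show ?thesis using P(2) by simp
qed

text \<open>A finite supremum of a nonempty set in \<open>enat\<close> is attained. The set contains
  0, witnessed by empty families of paths.\<close>

lemma vertex_connectivity_eq_enatD:
  assumes "vertex_connectivity G = enat n"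
  shows "graph_k_connected n G" "\<not> graph_k_connected (Suc n) G"
proof -
  let ?K = "{k. graph_k_connected k G}"
  have sup: "Sup (enat ` ?K) = enat n" using assms unfolding vertex_connectivity_def .
  have "0 \<in> ?K"
    unfolding graph_k_connected_def internally_disjoint_paths_def
    by (auto intro!: exI[of _ "{}"])
  then have ne: "enat ` ?K \<noteq> {}" by blast
  then have "finite (enat ` ?K)" "Max (enat ` ?K) = enat n"
    using sup unfolding Sup_enat_def by (auto split: if_splits)
  then have "enat n \<in> enat ` ?K" using Max_in[OF _ ne] by metis
  then show "graph_k_connected n G" by auto
  show "\<not> graph_k_connected (Suc n) G"
  proof
    assume "graph_k_connected (Suc n) G"
    then have "enat (Suc n) \<le> Sup (enat ` ?K)" by (intro Sup_upper) auto
    then show False using sup by simp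
  qed
qed

section \<open>The two obstructions to connectedness of the neighbourhood complex\<close>

text \<open>Strictness survives the supremum because the admissible \<open>k\<close> are integers,
  hence bounded by \<open>n - 1\<close>.\<close>

lemma Conn_lessI:
  assumes "\<And>k. int n \<le> k \<Longrightarrow> \<not> space_k_connected k X"
  shows "Conn X < ereal (real n)"
proof -
  have "Conn X \<le> ereal (real n - 1)"
    unfolding Conn_def
  proof (rule SUP_least)
    fix k assume "k \<in> {k. space_k_connected k X}"
    then have "k < int n" using assms not_less by blast
    then have "real_of_int k \<le> real n - 1" by linarith
    then show "ereal (real_of_int k) \<le> ereal (real n - 1)" by simp
  qed
  also have "\<dots> < ereal (real n)" by simp
  finally show ?thesis .
qed

lemma neighbourhood_complexI:
  "\<sigma> \<subseteq> verts G \<Longrightarrow> w \<in> verts G \<Longrightarrow> (\<And>v. v \<in> \<sigma> \<Longrightarrow> adj G w v) \<Longrightarrow> \<sigma> \<in> neighbourhood_complex G"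
  unfolding neighbourhood_complex_def nbhd_def by blast

lemma neighbourhood_complexE:
  assumes "\<sigma> \<in> neighbourhood_complex G"
  obtains w where "w \<in> verts G" "\<sigma> \<subseteq> verts G" "\<And>v. v \<in> \<sigma> \<Longrightarrow> adj G w v"
  using assms unfolding neighbourhood_complex_def nbhd_def by blast

text \<open>
  By stiffness the closed neighbourhood of a simplicial vertex \<open>v\<close> spans a sphere that is a retract
  of the whole complex: \<open>N(v)\<close> lies in no other neighbourhood, so everything outside can be
  collapsed to \<open>v\<close>.
\<close>

lemma simplicial_obstruction:
  assumes G: "graph G" and stiff: "stiff G" and two: "2 \<le> card (verts G)"
    and v: "sgraph.simplicial (adj G) (verts G) v"
    and k: "int (card (sgraph.nb (adj G) (verts G) v)) \<le> k + 1"
  shows "\<not> space_k_connected k (geometric_realization (neighbourhood_complex G))"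
proof -
  interpret graph G by fact
  interpret sg: sgraph "adj G" by (rule sgraph_adj) fact
  define N where "N = sg.nb (verts G) v"
  have N_eq: "N = nbhd G v" unfolding N_def sg.nb_def nbhd_def using adj_in_verts by auto
  have vV: "v \<in> verts G" and clN: "sg.clique N" using v unfolding sg.simplicial_def N_def by auto
  have NV: "N \<subseteq> verts G" and vN: "v \<notin> N" and adjN: "\<forall>u\<in>N. adj G v u"
    unfolding N_def sg.nb_def using sg.E_irrefl by auto
  have finN: "finite N" using NV finite_verts finite_subset by blast
  \<comment> \<open>An isolated vertex would have its empty neighbourhood contained in that of any
    second vertex.\<close>
  have "N \<noteq> {}"
  proof
    assume "N = {}"
    have "verts G \<noteq> {v}" using two by auto
    then obtain u where "u \<in> verts G" "v \<noteq> u" using vV by auto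
    moreover have "nbhd G v \<subseteq> nbhd G u" using \<open>N = {}\<close> unfolding N_eq by simp
    ultimately show False using stiff vV unfolding stiff_def by metis
  qed
  define D where "D = insert v N"
  \<comment> \<open>The sphere has dimension \<open>card N - 1\<close>; the natural-number
    subtraction is exact because \<open>N\<close> is nonempty.\<close>
  have D: "finite D" "card D = (card N - 1) + 2"
    using finN vN \<open>N \<noteq> {}\<close> by (auto simp: D_def Suc_le_eq card_gt_0_iff)
  have DV: "D \<subseteq> verts G" using vV NV by (simp add: D_def)
  have clD: "sg.clique D" unfolding D_def by (rule sg.clique_insert[OF clN adjN])
  define \<phi> where "\<phi> w = (if w \<in> D then w else v)" for w
  show ?thesis
  proof (rule not_space_k_connectedI[OF finite_verts _ D, where \<phi> = \<phi> and g = id])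
    show "neighbourhood_complex G \<subseteq> Pow (verts G)" unfolding neighbourhood_complex_def by blast
    show "\<phi> ` verts G \<subseteq> D" by (auto simp: \<phi>_def D_def)
    show "\<phi> ` \<sigma> \<noteq> D" if \<sigma>: "\<sigma> \<in> neighbourhood_complex G" for \<sigma>
    proof
      assume eq: "\<phi> ` \<sigma> = D"
      obtain w where w: "w \<in> verts G" "\<sigma> \<subseteq> verts G" "\<And>u. u \<in> \<sigma> \<Longrightarrow> adj G w u"
        using neighbourhood_complexE[OF \<sigma>] by blast
      have "N \<subseteq> \<sigma>"
      proof
        fix c assume c: "c \<in> N"
        then have "c \<in> \<phi> ` \<sigma>" by (simp add: eq D_def)
        then obtain x where "x \<in> \<sigma>" "\<phi> x = c" by blast
        then show "c \<in> \<sigma>" using c vN by (auto simp: \<phi>_def split: if_splits)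
      qed
      \<comment> \<open>Points of \<open>N\<close> have no preimage but themselves, so
        \<open>w\<close> dominates \<open>v\<close> and stiffness gives \<open>w = v\<close>. But
        every neighbour of \<open>v\<close> is fixed by \<open>\<phi>\<close>, so nothing in the
        simplex maps to \<open>v\<close>.\<close>
      then have "nbhd G v \<subseteq> nbhd G w" using w(3) unfolding N_eq nbhd_def by blast
      then have "w = v" using stiff vV w(1) unfolding stiff_def by metis
      have "v \<in> \<phi> ` \<sigma>" by (simp add: eq D_def)
      then obtain x where x: "x \<in> \<sigma>" "\<phi> x = v" by blast
      then have "adj G v x" using w(3) \<open>w = v\<close> by blast
      then have "x \<in> N" using x(1) w(2) unfolding N_def sg.nb_def by blast
      then show False using x vN by (simp add: \<phi>_def D_def)
    qed
    \<comment> \<open>The vertex \<open>d\<close> missing from a proper face of the clique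
      \<open>D\<close> is a common neighbour of that face.\<close>
    show "id \<in> simplex_bd D \<rightarrow> realization (neighbourhood_complex G)"
    proof
      fix x assume x: "x \<in> simplex_bd D"
      then obtain d where d: "d \<in> D" "x d = 0" unfolding simplex_bd_def by blast
      have xs: "x \<in> full_simplex D" using x unfolding simplex_bd_def by blast
      have supp: "u \<in> D" "u \<noteq> d" if "x u \<noteq> 0" for u
        using that xs d unfolding full_simplex_def by auto
      have "{v. x v \<noteq> 0} \<in> neighbourhood_complex G"
      proof (rule neighbourhood_complexI)
        show "d \<in> verts G" using d DV by blast
        show "{v. x v \<noteq> 0} \<subseteq> verts G" using supp DV by blast
        show "adj G d u" if "u \<in> {v. x v \<noteq> 0}" for u
          using that supp[of u] d clD unfolding sg.clique_def by auto
      qed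
      then show "id x \<in> realization (neighbourhood_complex G)" using realizationI[OF xs D(1)] by simp
    qed
    show "x (\<phi> u) \<noteq> 0" if "x \<in> simplex_bd D" "id x u \<noteq> 0" for x u
      using that unfolding simplex_bd_def full_simplex_def by (auto simp: \<phi>_def)
    show "int (card N - 1) \<le> k" using k \<open>N \<noteq> {}\<close> finN unfolding N_def[symmetric]
      by (simp add: of_nat_diff Suc_le_eq card_gt_0_iff)
  qed (simp add: continuous_on_id)
qed

text \<open>In general larger than the neighbourhood complex of the subgraph induced by
  \<open>W\<close>: the common neighbour may lie outside \<open>W\<close>.\<close>

definition complex_on :: "('a, 'b) pre_digraph \<Rightarrow> 'a set \<Rightarrow> 'a set set" where
  "complex_on G W = {\<sigma> \<in> neighbourhood_complex G. \<sigma> \<subseteq> W}"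

text \<open>Two cliques \<open>T + u\<close> and \<open>T + u'\<close> can be exchanged because each
  \<open>t\<close> in \<open>T\<close> is a common neighbour of \<open>u\<close>, \<open>u'\<close>
  and the rest of \<open>T\<close>, which supplies the simplices needed for the subdivision.\<close>

lemma fillable_side:
  assumes G: "graph G" and chordal: "chordal G"
    and sep: "sgraph.separation (adj G) (verts G) A S B" and S: "sgraph.clique (adj G) S" "card S = n"
    and conn: "graph_k_connected n G"
    and degree: "\<And>v. sgraph.simplicial (adj G) (verts G) v \<Longrightarrow> n < card (sgraph.nb (adj G) (verts G) v)"
  obtains a where "a \<in> A" "\<forall>s\<in>S. adj G a s" "fillable (complex_on G (A \<union> S)) (insert a S)"
proof -
  interpret graph G by fact
  interpret sg: sgraph "adj G" by (rule sgraph_adj) fact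
  have ASV: "A \<union> S \<subseteq> verts G" using sep unfolding sg.separation_def by blast
  have finAS: "finite (A \<union> S)" using ASV finite_verts finite_subset by blast
  show ?thesis
  proof (rule sg.clique_chain_induction[where F = "fillable (complex_on G (A \<union> S))",
        OF finite_verts no_hole_if_chordal[OF G chordal] sep S card_separator_ge[OF G conn] degree])
    fix K w assume K: "K \<subseteq> A \<union> S" and w: "w \<in> verts G" "\<forall>u\<in>K. adj G w u"
    show "fillable (complex_on G (A \<union> S)) K"
    proof (rule fillable_face)
      show "finite K" using K finAS finite_subset by blast
      show "\<sigma> \<in> complex_on G (A \<union> S)" if "\<sigma> \<subseteq> K" for \<sigma>
        unfolding complex_on_def using neighbourhood_complexI[of \<sigma> G w] that K ASV w by blast
    qed
  next
    fix T u u'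
    assume T: "T \<subseteq> A \<union> S" "u \<in> A \<union> S" "u' \<in> A \<union> S" "u \<notin> T" "u' \<notin> T" "u \<noteq> u'"
      and cl: "sg.clique (insert u T)" "sg.clique (insert u' T)"
      and fill: "fillable (complex_on G (A \<union> S)) (insert u' T)"
    show "fillable (complex_on G (A \<union> S)) (insert u T)"
    proof (rule fillable_exchange[OF _ T(4,5,6) _ fill])
      show "finite T" using T(1) finAS finite_subset by blast
      fix t \<sigma> assume t: "t \<in> T" and \<sigma>: "\<sigma> \<subseteq> insert u (insert u' (T - {t}))"
      have "adj G t v" if v: "v \<in> \<sigma>" for v
      proof -
        consider "v = u" | "v = u'" | "v \<in> T" "v \<noteq> t" using v \<sigma> by blast
        then show ?thesis
          using t cl T(4,5) unfolding sg.clique_def by cases auto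
      qed
      then have "\<sigma> \<in> neighbourhood_complex G"
        using neighbourhood_complexI[of \<sigma> G t] \<sigma> t T(1-3) ASV by blast
      then show "\<sigma> \<in> complex_on G (A \<union> S)" unfolding complex_on_def using \<sigma> T(1-3) by blast
    qed
  qed (use that in blast)+
qed

lemma separator_obstruction:
  assumes G: "graph G" and chordal: "chordal G"
    and sep: "sgraph.separation (adj G) (verts G) A S B" and S: "sgraph.clique (adj G) S" "card S = n"
    and conn: "graph_k_connected n G"
    and degree: "\<And>v. sgraph.simplicial (adj G) (verts G) v \<Longrightarrow> n < card (sgraph.nb (adj G) (verts G) v)"
    and k: "int n \<le> k"
  shows "\<not> space_k_connected k (geometric_realization (neighbourhood_complex G))"
proof -
  interpret graph G by fact
  interpret sg: sgraph "adj G" by (rule sgraph_adj) fact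
  have sp: "verts G = A \<union> S \<union> B" "A \<inter> S = {}" "B \<inter> S = {}" "A \<inter> B = {}"
    and AB: "\<And>a b. a \<in> A \<Longrightarrow> b \<in> B \<Longrightarrow> \<not> adj G a b"
    using sep unfolding sg.separation_def by auto
  obtain a where a: "a \<in> A" "\<forall>s\<in>S. adj G a s" "fillable (complex_on G (A \<union> S)) (insert a S)"
    by (rule fillable_side[OF G chordal sep S conn degree])
  obtain b where b: "b \<in> B" "\<forall>s\<in>S. adj G b s" "fillable (complex_on G (B \<union> S)) (insert b S)"
    by (rule fillable_side[OF G chordal sg.separation_commute[OF sep] S conn degree])
  have finS: "finite S" using sp(1) by (metis finite_Un finite_verts)
  have ab: "a \<notin> S" "b \<notin> S" "a \<noteq> b" using a(1) b(1) sp by auto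
  define D where "D = insert a (insert b S)"
  have D: "finite D" "card D = n + 2" using finS ab S(2) by (auto simp: D_def)
  have sub: "complex_on G W \<subseteq> neighbourhood_complex G" for W unfolding complex_on_def by blast
  have faces: "\<sigma> \<in> neighbourhood_complex G" if s: "s \<in> S" and \<sigma>: "\<sigma> \<subseteq> insert a (insert b (S - {s}))" for s \<sigma>
  proof (rule neighbourhood_complexI)
    show "\<sigma> \<subseteq> verts G" "s \<in> verts G" using \<sigma> s a(1) b(1) sp(1) by auto
    show "adj G s v" if v: "v \<in> \<sigma>" for v
    proof -
      consider "v = a" | "v = b" | "v \<in> S" "v \<noteq> s" using v \<sigma> by blast
      then show ?thesis
        using s a(2) b(2) sg.E_sym S(1) unfolding sg.clique_def by cases auto
    qed
  qed
  obtain g where g: "continuous_on (simplex_bd D) g" "g \<in> simplex_bd D \<rightarrow> realization (neighbourhood_complex G)"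
    and gA: "\<And>x. x \<in> simplex_bd D \<Longrightarrow> x b = 0 \<Longrightarrow> g x \<in> realization (complex_on G (A \<union> S))"
    and gB: "\<And>x. x \<in> simplex_bd D \<Longrightarrow> x a = 0 \<Longrightarrow> x b \<noteq> 0 \<Longrightarrow> g x \<in> realization (complex_on G (B \<union> S))"
    and gid: "\<And>x. x \<in> simplex_bd D \<Longrightarrow> (\<exists>s\<in>S. x s = 0) \<or> x a = 0 \<and> x b = 0 \<Longrightarrow> g x = x"
    unfolding D_def by (rule fillable_join[OF finS ab a(3) sub b(3) sub faces]) blast+
  define \<phi> where "\<phi> w = (if w \<in> A then a else if w \<in> B then b else w)" for w
  have \<phi>D: "\<phi> d = d" if "d \<in> D" for d using that a(1) b(1) sp(2-4) by (auto simp: \<phi>_def D_def)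
  have \<phi>V: "\<phi> ` verts G \<subseteq> D" using sp(1) by (auto simp: \<phi>_def D_def)
  have \<phi>S: "w = s" if "\<phi> w = s" "s \<in> S" for w s using that ab by (auto simp: \<phi>_def split: if_splits)
  have supp: "{v. y v \<noteq> 0} \<subseteq> W" if "y \<in> realization (complex_on G W)" for y W
    using that unfolding realization_def complex_on_def by blast
  show ?thesis
  proof (rule not_space_k_connectedI[OF finite_verts _ D \<phi>V _ g _ k])
    show KV: "neighbourhood_complex G \<subseteq> Pow (verts G)" unfolding neighbourhood_complex_def by blast
    show "\<phi> ` \<sigma> \<noteq> D" if \<sigma>: "\<sigma> \<in> neighbourhood_complex G" for \<sigma>
    proof
      assume eq: "\<phi> ` \<sigma> = D"
      obtain w where w: "w \<in> verts G" "\<sigma> \<subseteq> verts G" "\<And>u. u \<in> \<sigma> \<Longrightarrow> adj G w u"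
        using neighbourhood_complexE[OF \<sigma>] by blast
      have "a \<in> \<phi> ` \<sigma>" by (simp add: eq D_def)
      then obtain x where x: "x \<in> \<sigma>" "\<phi> x = a" by blast
      have "b \<in> \<phi> ` \<sigma>" by (simp add: eq D_def)
      then obtain y where y: "y \<in> \<sigma>" "\<phi> y = b" by blast
      have "x \<in> A" using x w(2) sp ab a(1) b(1) by (auto simp: \<phi>_def split: if_splits)
      have "y \<in> B" using y w(2) sp ab a(1) b(1) by (auto simp: \<phi>_def split: if_splits)
      then have "w \<notin> A" using AB w(3)[OF y(1)] by blast
      moreover have "w \<notin> B" using AB[OF \<open>x \<in> A\<close>] sg.E_sym[OF w(3)[OF x(1)]] by blast
      ultimately have "w \<in> S" using w(1) sp(1) by blast
      then have "w \<in> \<phi> ` \<sigma>" by (simp add: eq D_def)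
      then obtain u where "u \<in> \<sigma>" "\<phi> u = w" by blast
      then have "w \<in> \<sigma>" using \<phi>S[OF \<open>\<phi> u = w\<close> \<open>w \<in> S\<close>] by simp
      then show False using w(3) sg.E_irrefl by blast
    qed
    \<comment> \<open>Where \<open>g\<close> is not known to be the identity, no coordinate in
      \<open>S\<close> vanishes and at most one of those at \<open>a\<close> and \<open>b\<close>
      does. If it is the one at \<open>a\<close>, then \<open>g x\<close> lies over
      \<open>B \<union> S\<close> and has no weight on \<open>A\<close>; symmetrically for
      \<open>b\<close>.\<close>
    show "x (\<phi> v) \<noteq> 0" if x: "x \<in> simplex_bd D" and v: "g x v \<noteq> 0" for x v
    proof
      assume zero: "x (\<phi> v) = 0"
      have "g x \<in> realization (neighbourhood_complex G)" using g(2) x by blast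
      then have "{v. g x v \<noteq> 0} \<subseteq> verts G" using KV unfolding realization_def by blast
      then have vV: "v \<in> verts G" using v by blast
      show False
      proof (cases "(\<exists>s\<in>S. x s = 0) \<or> x a = 0 \<and> x b = 0")
        case True
        then have "x v \<noteq> 0" using gid[OF x] v by simp
        moreover from this have "v \<in> D" using x unfolding simplex_bd_def full_simplex_def by blast
        ultimately show False using zero \<phi>D by simp
      next
        case False
        consider "v \<in> A" | "v \<in> B" | "v \<in> S" using vV sp(1) by blast
        then show False
        proof cases
          case 1
          then have "x a = 0" using zero by (simp add: \<phi>_def)
          then have "{v. g x v \<noteq> 0} \<subseteq> B \<union> S" using supp[OF gB[OF x]] False by blast
          then show False using 1 v sp by blast
        next
          case 2
          then have "v \<notin> A" using sp(4) by blast
          then have "x b = 0" using zero 2 by (simp add: \<phi>_def)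
          then have "{v. g x v \<noteq> 0} \<subseteq> A \<union> S" using supp[OF gA[OF x]] by blast
          then show False using 2 v sp by blast
        next
          case 3
          then have "\<phi> v = v" using \<phi>D by (simp add: D_def)
          then show False using 3 zero False by auto
        qed
      qed
    qed
  qed
qed

theorem theorem5p9:
  fixes G :: "('a, 'b) pre_digraph" and n :: nat
  assumes "graph G"
    and "chordal G"
    and "stiff G"
    and "vertex_connectivity G = enat n"
  shows "Conn (geometric_realization (neighbourhood_complex G)) < ereal (real n)"
proof (rule Conn_lessI)
  fix k assume k: "int n \<le> k"
  interpret graph G by fact
  interpret sg: sgraph "adj G" by (rule sgraph_adj) fact
  note conn = vertex_connectivity_eq_enatD[OF assms(4)]
  obtain x y where xy: "x \<in> verts G" "y \<in> verts G" "x \<noteq> y"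
      "\<nexists>P. finite P \<and> Suc n \<le> card P \<and> internally_disjoint_paths G x y P"
    using conn(2) unfolding graph_k_connected_def by blast
  have two: "2 \<le> card (verts G)"
    using card_mono[of "verts G" "{x, y}"] xy by simp
  show "\<not> space_k_connected k (geometric_realization (neighbourhood_complex G))"
  proof (cases "\<exists>v. sg.simplicial (verts G) v \<and> card (sg.nb (verts G) v) \<le> n")
    case True
    then show ?thesis using simplicial_obstruction[OF assms(1,3) two] k by force
  next
    case False
    then have degree: "n < card (sg.nb (verts G) v)" if "sg.simplicial (verts G) v" for v
      using that not_less by blast
    \<comment> \<open>In a complete graph on at most \<open>n + 1\<close> vertices every vertex is
      simplicial of degree at most \<open>n\<close>.\<close>
    have not_small: "\<not> (sg.clique (verts G) \<and> card (verts G) \<le> Suc n)"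
    proof
      assume small: "sg.clique (verts G) \<and> card (verts G) \<le> Suc n"
      have "sg.nb (verts G) x \<subseteq> verts G - {x}" unfolding sg.nb_def using sg.E_irrefl by blast
      then have "card (sg.nb (verts G) x) \<le> n" and "sg.clique (sg.nb (verts G) x)"
        using card_mono[of "verts G - {x}" "sg.nb (verts G) x"] small xy(1)
        by (auto elim: sg.clique_subset)
      then show False using degree[of x] xy(1) unfolding sg.simplicial_def by simp
    qed
    \<comment> \<open>If every clique separator had at least \<open>n + 1\<close> vertices, there
      would be \<open>n + 1\<close> disjoint paths from \<open>x\<close> to \<open>y\<close>, the
      pair chosen to violate this. The matching lower bound on \<open>card S\<close> comes from
      n-connectedness.\<close>
    have "\<exists>A S B. sg.separation (verts G) A S B \<and> sg.clique S \<and> card S \<le> n"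
    proof (rule ccontr)
      assume "\<not> ?thesis"
      then have large: "Suc n \<le> card S" if "sg.separation (verts G) A S B" "sg.clique S" for A S B
        using that not_less_eq_eq by blast
      have "\<exists>P. finite P \<and> Suc n \<le> card P \<and> (\<forall>p\<in>P. sg.path (verts G) p x y) \<and>
          (\<forall>p\<in>P. \<forall>q\<in>P. p \<noteq> q \<longrightarrow> set p \<inter> set q = {x, y})"
        by (rule sg.disjoint_paths[OF finite_verts no_hole_if_chordal[OF assms(1,2)] _ not_small xy(1-3)])
          (rule large)
      then obtain P where P: "finite P" "Suc n \<le> card P" "\<forall>p\<in>P. sg.path (verts G) p x y"
          "\<forall>p\<in>P. \<forall>q\<in>P. p \<noteq> q \<longrightarrow> set p \<inter> set q = {x, y}" by (elim exE conjE)
      have "vpath p G \<and> hd p = x \<and> last p = y" if "p \<in> P" for p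
        using vpath_iff_path[OF sgraph_adj[OF assms(1)], of p x y] P(3) that by simp
      then have "internally_disjoint_paths G x y P"
        using P(4) unfolding internally_disjoint_paths_def by simp
      then show False using P(1,2) xy(4) by auto
    qed
    then obtain A S B where s: "sg.separation (verts G) A S B" "sg.clique S" "card S \<le> n" by blast
    then have "card S = n" using card_separator_ge[OF assms(1) conn(1) s(1)] by simp
    then show ?thesis using separator_obstruction[OF assms(1,2) s(1,2) _ conn(1) degree k] by blast
  qed
qed

end
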